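(* Let $\Omega$ be a finite set of cardinality $d\ge 3$, let $T_d=(V,E)$ be the $d$-regular tree with a fixed legal coloring $l:E\to\Omega$ and base vertex $b\in V$, and let $p$ be a prime. Let $F\le F'\le\widehat{F}\le\mathrm{Sym}(\Omega)$ and let $F(p)\le F$ be a $p$-Sylow subgroup such that $F(p)_{\omega}\le F_{\omega}$ is a $p$-Sylow subgroup for all $\omega\in\Omega$. Set $S:=\mathrm{U}(F(p))_{b}$. Then $$\mathrm{Comm}_{\mathrm{G}(F,F')}(S)=\big\langle\mathrm{U}(\{\mathrm{id}\}),\ \mathrm{Comm}_{\mathrm{G}(F,F')_{b}}(S)\big\rangle,$$ and this group contains the subgroup $$\big\langle \mathrm{G}(F(p),F'),\ \{\Gamma_{V/L}(N_{F}(F(p))/F(p))\mid L\le S\text{ open}\}\big\rangle$$ generated by $\mathrm{G}(F(p),F')$ together with all the sets $\Gamma_{V/L}(N_{F}(F(p))/F(p))$, where $L$ ranges over the open subgroups of $S$.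
   Context: Graphs are in Serre's sense: $T_d=(V,E)$ has vertex set $V$ and a set $E$ of oriented edges, with origin and terminus maps $o,t:E\to V$ and a fixed-point-free involution $e\mapsto\overline{e}$ on $E$ reversing orientation. For $x\in V$ let $E(x)=\{e\in E\mid o(e)=x\}$. A legal coloring is a map $l:E\to\Omega$ such that $l(e)=l(\overline{e})$ for all $e\in E$ and, for every $x\in V$, the restriction $l_x:=l|_{E(x)}:E(x)\to\Omega$ is a bijection. For $g\in\mathrm{Aut}(T_d)$ and $x\in V$ put $\sigma(g,x):=l_{gx}\circ g\circ l_x^{-1}\in\mathrm{Sym}(\Omega)$. For $F\le\mathrm{Sym}(\Omega)$ define: - $\mathrm{U}(F):=\{g\in\mathrm{Aut}(T_d)\mid \forall x\in V:\ \sigma(g,x)\in F\}$, with the subspace topology from $\mathrm{Aut}(T_d)$, which carries the permutation topology for its action on $V$; - $\mathrm{G}(F):=\{g\in\mathrm{Aut}(T_d)\mid \{x\in V\mid\sigma(g,x)\notin F\}\text{ is finite}\}$, a group equipped with the unique group topology making the inclusion $\mathrm{U}(F)\to\mathrm{G}(F)$ continuous and open; - $\widehat{F}:=\prod_{i\in I}\mathrm{Sym}(\Omega_i)\le\mathrm{Sym}(\Omega)$, where $\Omega=\bigsqcup_{i\in I}\Omega_i$ is the partition $F\backslash\Omega$ of $\Omega$ into $F$-orbits; - $\mathrm{G}(F,F'):=\mathrm{G}(F)\cap\mathrm{U}(F')$ for $F\le F'\le\mathrm{Sym}(\Omega)$; in particular $\mathrm{G}(F(p),F')=\mathrm{G}(F(p))\cap\mathrm{U}(F')$.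 Subscripts $b$ and $\omega$ denote point stabilizers. For groups $H\le G$, $\mathrm{Comm}_G(H):=\{g\in G\mid [H:H\cap gHg^{-1}]<\infty\text{ and }[gHg^{-1}:gHg^{-1}\cap H]<\infty\}$. Given partitions $\mathcal{P}=(P_i)_{i\in I}$ of $V$ and $\mathcal{H}=(H_j)_{j\in J}$ of a subgroup $H\le\mathrm{Sym}(\Omega)$, let $$\Gamma_{\mathcal{P}}(\mathcal{H}):=\{g\in\mathrm{Aut}(T_d)\mid\forall i\in I\ \exists j\in J\ \forall v\in P_i:\ \sigma(g,v)\in H_j\}.$$ Here $V/L$ is the partition of $V$ into $L$-orbits, and $N_F(F(p))/F(p)$ is the partition of the normalizer $N_F(F(p))$ of $F(p)$ in $F$ into cosets of $F(p)$. *)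

theory Defs
  imports
    "HOL-Analysis.Function_Topology"
    "HOL-Algebra.Generated_Groups"
    "HOL-Algebra.Group_Action"
    "HOL-Algebra.Product_Groups"
    "HOL-Algebra.Sylow"
    "Graph_Theory.Bidirected_Digraph"
    "Graph_Theory.Digraph_Component"
begin

text \<open>
  Subgroups are sets of elements of an ambient group \<open>G\<close>; a subgroup \<open>H\<close> regarded as a group in its
  own right is \<open>G\<lparr>carrier := H\<rparr>\<close>. The symmetric group of \<open>\<Omega>\<close> is \<^term>\<open>BijGroup \<Omega>\<close>, whose elements are
  extensional functions on \<open>\<Omega>\<close>.
\<close>

definition sylow_subgroup :: "nat \<Rightarrow> ('a, 'b) monoid_scheme \<Rightarrow> 'a set \<Rightarrow> bool" where
  "sylow_subgroup p G P \<longleftrightarrow> subgroup P G \<and> card P = p ^ multiplicity p (order G)"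

definition finite_index :: "('a, 'b) monoid_scheme \<Rightarrow> 'a set \<Rightarrow> 'a set \<Rightarrow> bool" where
  "finite_index G H K \<longleftrightarrow> finite (rcosets\<^bsub>G\<lparr>carrier := H\<rparr>\<^esub> K)"

definition commensurator :: "('a, 'b) monoid_scheme \<Rightarrow> 'a set \<Rightarrow> 'a set" where
  "commensurator G H =
     {g \<in> carrier G.
        let K = g <#\<^bsub>G\<^esub> H #>\<^bsub>G\<^esub> inv\<^bsub>G\<^esub> g
        in finite_index G H (H \<inter> K) \<and> finite_index G K (K \<inter> H)}"

definition permutation_topology ::
    "('a, 'b) monoid_scheme \<Rightarrow> 'x set \<Rightarrow> ('a \<Rightarrow> 'x \<Rightarrow> 'x) \<Rightarrow> 'a topology" where
  "permutation_topology G X \<phi> =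
     topology_generated_by {{g \<in> carrier G. \<phi> g x = y} |x y. x \<in> X \<and> y \<in> X}"

text \<open>
  The product of the symmetric groups of the \<open>F\<close>-orbits, embedded in the symmetric group of \<open>\<Omega>\<close>: a
  family \<open>s\<close> of permutations indexed by the orbits acts on every \<open>\<omega>\<close> through its component at the
  orbit of \<open>\<omega>\<close>.
\<close>

definition orbit_product :: "'c set \<Rightarrow> ('c \<Rightarrow> 'c) set \<Rightarrow> ('c \<Rightarrow> 'c) set" where
  "orbit_product \<Omega> F =
     (let G = BijGroup \<Omega>\<lparr>carrier := F\<rparr>
      in (\<lambda>s. \<lambda>\<omega>\<in>\<Omega>. s (orbit G (\<lambda>a. a) \<omega>) \<omega>) `
           carrier (product_group (orbits G \<Omega> (\<lambda>a. a)) BijGroup))"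

text \<open>
  A graph in Serre's sense is a \<^const>\<open>bidirected_digraph\<close>, with \<^const>\<open>tail\<close> and \<^const>\<open>head\<close> as
  origin and terminus. There \<open>arev\<close> is fixed-point free on arcs and, by convention, the identity
  outside the set of arcs. The library notion of cycle admits the closed walk consisting of an arc
  followed by its reverse, so circuits are required not to contain both orientations of an edge.
\<close>

definition circuit :: "('v, 'e) pre_digraph \<Rightarrow> ('e \<Rightarrow> 'e) \<Rightarrow> 'e awalk \<Rightarrow> bool" where
  "circuit T arev p \<longleftrightarrow> pre_digraph.cycle T p \<and> (\<forall>e\<in>set p. arev e \<notin> set p)"

definition serre_tree :: "('v, 'e) pre_digraph \<Rightarrow> ('e \<Rightarrow> 'e) \<Rightarrow> bool" where
  "serre_tree T arev \<longleftrightarrow>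
     bidirected_digraph T arev \<and> Digraph_Component.connected T \<and> (\<nexists>p. circuit T arev p)"

definition regular_tree :: "nat \<Rightarrow> ('v, 'e) pre_digraph \<Rightarrow> ('e \<Rightarrow> 'e) \<Rightarrow> bool" where
  "regular_tree d T arev \<longleftrightarrow>
     serre_tree T arev \<and> (\<forall>x\<in>verts T. finite (out_arcs T x) \<and> out_degree T x = d)"

definition legal_coloring ::
    "('v, 'e) pre_digraph \<Rightarrow> ('e \<Rightarrow> 'e) \<Rightarrow> 'c set \<Rightarrow> ('e \<Rightarrow> 'c) \<Rightarrow> bool" where
  "legal_coloring T arev \<Omega> l \<longleftrightarrow>
     (\<forall>e\<in>arcs T. l e \<in> \<Omega> \<and> l (arev e) = l e) \<and>
     (\<forall>x\<in>verts T. bij_betw l (out_arcs T x) \<Omega>)"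

text \<open>An automorphism is a pair of a bijection of the vertices and a bijection of the arcs.\<close>

definition aut_group ::
    "('v, 'e) pre_digraph \<Rightarrow> ('e \<Rightarrow> 'e) \<Rightarrow> (('v \<Rightarrow> 'v) \<times> ('e \<Rightarrow> 'e)) monoid" where
  "aut_group T arev =
     (BijGroup (verts T) \<times>\<times> BijGroup (arcs T))
       \<lparr>carrier := {g \<in> Bij (verts T) \<times> Bij (arcs T).
          \<forall>e\<in>arcs T. tail T (snd g e) = fst g (tail T e) \<and>
                      head T (snd g e) = fst g (head T e) \<and>
                      snd g (arev e) = arev (snd g e)}\<rparr>"

text \<open>
  The coloring at \<open>x\<close> is the restriction of \<open>l\<close> to \<open>out_arcs T x\<close>, and \<open>snd g\<close> maps
  \<open>out_arcs T x\<close> to \<open>out_arcs T (fst g x)\<close>.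
\<close>

definition local_action ::
    "('v, 'e) pre_digraph \<Rightarrow> 'c set \<Rightarrow> ('e \<Rightarrow> 'c) \<Rightarrow> ('v \<Rightarrow> 'v) \<times> ('e \<Rightarrow> 'e) \<Rightarrow> 'v \<Rightarrow> 'c \<Rightarrow> 'c" where
  "local_action T \<Omega> l g x = (\<lambda>\<omega>\<in>\<Omega>. l (snd g (inv_into (out_arcs T x) l \<omega>)))"

definition universal_group ::
    "('v, 'e) pre_digraph \<Rightarrow> ('e \<Rightarrow> 'e) \<Rightarrow> 'c set \<Rightarrow> ('e \<Rightarrow> 'c) \<Rightarrow> ('c \<Rightarrow> 'c) set
       \<Rightarrow> (('v \<Rightarrow> 'v) \<times> ('e \<Rightarrow> 'e)) set" where
  "universal_group T arev \<Omega> l F =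
     {g \<in> carrier (aut_group T arev). \<forall>x\<in>verts T. local_action T \<Omega> l g x \<in> F}"

definition almost_universal_group ::
    "('v, 'e) pre_digraph \<Rightarrow> ('e \<Rightarrow> 'e) \<Rightarrow> 'c set \<Rightarrow> ('e \<Rightarrow> 'c) \<Rightarrow> ('c \<Rightarrow> 'c) set
       \<Rightarrow> (('v \<Rightarrow> 'v) \<times> ('e \<Rightarrow> 'e)) set" where
  "almost_universal_group T arev \<Omega> l F =
     {g \<in> carrier (aut_group T arev). finite {x \<in> verts T. local_action T \<Omega> l g x \<notin> F}}"

definition restricted_universal_group ::
    "('v, 'e) pre_digraph \<Rightarrow> ('e \<Rightarrow> 'e) \<Rightarrow> 'c set \<Rightarrow> ('e \<Rightarrow> 'c) \<Rightarrow> ('c \<Rightarrow> 'c) set \<Rightarrow> ('c \<Rightarrow> 'c) set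
       \<Rightarrow> (('v \<Rightarrow> 'v) \<times> ('e \<Rightarrow> 'e)) set" where
  "restricted_universal_group T arev \<Omega> l F F' =
     almost_universal_group T arev \<Omega> l F \<inter> universal_group T arev \<Omega> l F'"

definition partition_group ::
    "('v, 'e) pre_digraph \<Rightarrow> ('e \<Rightarrow> 'e) \<Rightarrow> 'c set \<Rightarrow> ('e \<Rightarrow> 'c) \<Rightarrow> 'v set set \<Rightarrow> ('c \<Rightarrow> 'c) set set
       \<Rightarrow> (('v \<Rightarrow> 'v) \<times> ('e \<Rightarrow> 'e)) set" where
  "partition_group T arev \<Omega> l \<P> \<H> =
     {g \<in> carrier (aut_group T arev).
        \<forall>P\<in>\<P>. \<exists>H\<in>\<H>. \<forall>v\<in>P. local_action T \<Omega> l g v \<in> H}"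

end

theory Submission
  imports Defs
begin

text \<open>
  Finite index is expressed by finite coverings by right cosets, a transitive and conjugation
  invariant relation, so that \<open>g\<close> commensurates \<open>S\<close> as soon as both \<open>g\<close> and its inverse conjugate
  the pointwise stabilizer in \<open>S\<close> of some ball around \<open>b\<close> into \<open>S\<close>. For \<open>g\<close> in \<open>G(F(p))\<close> take a ball
  containing the neighborhoods of all vertices with local action outside \<open>F(p)\<close>. For \<open>g\<close> in
  \<open>\<Gamma>(N/F(p))\<close> the coset condition makes \<open>\<sigma>(g u inv g, g x)\<close> lie in \<open>F(p)\<close> for \<open>u\<close> in the group \<open>L\<close>; the
  inverse of \<open>g\<close> need not satisfy a condition of the same kind a priori, and is treated by induction on
  the distance to \<open>b\<close>. The equality holds because \<open>U({id})\<close> commensurates \<open>S\<close> and is transitive on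
  vertices.
\<close>

text \<open>Conjugation turns local actions into \<sigma>(g u inv g, g x) = \<sigma>(g, u x)
  \<sigma>(u, x) inv \<sigma>(g, x), so \<sigma>(g, _) matters only through its values at
  \<open>x\<close> and \<open>u x\<close>. For the inverse of an element of \<Gamma> the cosets are
  constant on orbits of g L inv g, whose relation to \<open>S\<close> is exactly what is to be
  shown. Equivalently, for w = inv g v g one has to know that \<open>x\<close> and
  \<open>w x\<close> lie in one \<open>L\<close>-orbit, while \<open>w\<close> itself is not yet
  known to be in \<open>S\<close>. The circle is broken because this relation sees \<open>w\<close>
  only on the ball reaching up to \<open>x\<close>: there \<open>w\<close> can be replaced by an
  element of \<open>L\<close>, constructed by prescribing its local actions. In a tree such a
  prescription is free except for agreement along each edge; proving this takes coordinates on the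
  vertices, namely reduced words in the colors. The same construction with trivial local actions
  supplies the elements of U({id}). Coverings replace indices because they can be composed and
  enlarged without intersecting subgroups at each step.\<close>

lemma mult_BijGroup: "f \<in> Bij S \<Longrightarrow> g \<in> Bij S \<Longrightarrow> f \<otimes>\<^bsub>BijGroup S\<^esub> g = compose S f g"
  by (simp add: BijGroup_def)

lemma carrier_BijGroup: "carrier (BijGroup S) = Bij S"
  by (simp add: BijGroup_def)

lemma Bij_inj: "f \<in> Bij S \<Longrightarrow> x \<in> S \<Longrightarrow> y \<in> S \<Longrightarrow> f x = f y \<Longrightarrow> x = y"
  by (auto simp: Bij_def bij_betw_def inj_on_def)

lemma Bij_surj: "f \<in> Bij S \<Longrightarrow> y \<in> S \<Longrightarrow> \<exists>x\<in>S. f x = y"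
  by (metis Bij_def IntD2 bij_betw_imp_surj_on imageE mem_Collect_eq)

lemma Bij_mem: "f \<in> Bij S \<Longrightarrow> x \<in> S \<Longrightarrow> f x \<in> S"
  by (auto simp: Bij_def bij_betw_def)

section \<open>Commensuration by finite coverings\<close>

context group
begin

text \<open>\<open>K\<close> need not lie in \<open>H\<close> and neither has to be a subgroup, so a
  covering survives enlarging \<open>K\<close> and chains through conjugates. For subgroups it
  expresses that \<open>H \<inter> K\<close> has finite index in \<open>H\<close>, see
  \<open>finite_rcosets_iff\<close>.\<close>

definition finitely_covered :: "'a set \<Rightarrow> 'a set \<Rightarrow> bool" where
  "finitely_covered H K \<longleftrightarrow> (\<exists>C. finite C \<and> C \<subseteq> carrier G \<and> H \<subseteq> (\<Union>c\<in>C. K #> c))"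

definition conj_set :: "'a \<Rightarrow> 'a set \<Rightarrow> 'a set" where
  "conj_set g H = g <# H #> inv g"

lemma mem_conj_set: "x \<in> conj_set g H \<longleftrightarrow> (\<exists>h\<in>H. x = g \<otimes> h \<otimes> inv g)"
  by (auto simp: conj_set_def l_coset_def r_coset_def)

lemma conj_set_subset: "g \<in> carrier G \<Longrightarrow> H \<subseteq> carrier G \<Longrightarrow> conj_set g H \<subseteq> carrier G"
  by (auto simp: mem_conj_set subset_iff)

lemma conj_set_one: "H \<subseteq> carrier G \<Longrightarrow> conj_set \<one> H = H"
  by (auto simp: set_eq_iff mem_conj_set subset_iff)

lemma conj_set_mult:
  assumes "g \<in> carrier G" "h \<in> carrier G" "H \<subseteq> carrier G"
  shows "conj_set g (conj_set h H) = conj_set (g \<otimes> h) H"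
proof -
  have image: "conj_set a K = (\<lambda>x. a \<otimes> x \<otimes> inv a) ` K" for a K
    by (auto simp: mem_conj_set)
  have "g \<otimes> (h \<otimes> x \<otimes> inv h) \<otimes> inv g = g \<otimes> h \<otimes> x \<otimes> inv (g \<otimes> h)" if "x \<in> H" for x
    using assms that by (simp add: inv_mult_group m_assoc subset_iff)
  then show ?thesis
    unfolding image image_image by (intro image_cong) auto
qed

lemma subgroup_conj_set:
  assumes "g \<in> carrier G" "subgroup H G"
  shows "subgroup (conj_set g H) G"
proof (rule subgroupI)
  interpret H: subgroup H G by fact
  show "conj_set g H \<subseteq> carrier G" using assms H.subset by (rule_tac conj_set_subset)
  show "conj_set g H \<noteq> {}" using H.one_closed unfolding conj_set_def l_coset_def r_coset_def by blast
  show "inv a \<in> conj_set g H" if "a \<in> conj_set g H" for a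
  proof -
    obtain h where h: "h \<in> H" "a = g \<otimes> h \<otimes> inv g" using \<open>a \<in> _\<close> by (auto simp: mem_conj_set)
    then have "inv a = g \<otimes> inv h \<otimes> inv g"
      using assms(1) by (simp add: inv_mult_group m_assoc)
    then show ?thesis using h(1) unfolding mem_conj_set by blast
  qed
  show "a \<otimes> a' \<in> conj_set g H" if a: "a \<in> conj_set g H" and a': "a' \<in> conj_set g H" for a a'
  proof -
    obtain h where h: "h \<in> H" "a = g \<otimes> h \<otimes> inv g" using a by (auto simp: mem_conj_set)
    obtain h' where h': "h' \<in> H" "a' = g \<otimes> h' \<otimes> inv g" using a' by (auto simp: mem_conj_set)
    have "inv g \<otimes> (g \<otimes> (h' \<otimes> inv g)) = h' \<otimes> inv g"
      using assms(1) h' by (simp add: m_assoc[symmetric])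
    then have "a \<otimes> a' = g \<otimes> (h \<otimes> h') \<otimes> inv g"
      using assms(1) h h' by (simp add: m_assoc)
    then show ?thesis using h(1) h'(1) unfolding mem_conj_set by blast
  qed
qed

lemma finitely_covered_refl: "K \<subseteq> carrier G \<Longrightarrow> finitely_covered K K"
  unfolding finitely_covered_def by (rule exI[of _ "{\<one>}"]) simp

lemma finitely_covered_mono:
  assumes "finitely_covered H K" "K \<subseteq> K'"
  shows "finitely_covered H K'"
proof -
  have "K #> c \<subseteq> K' #> c" for c
    using assms(2) by (auto simp: r_coset_def)
  then have "(\<Union>c\<in>C. K #> c) \<subseteq> (\<Union>c\<in>C. K' #> c)" for C
    by (intro UN_mono) auto
  then show ?thesis using assms(1) unfolding finitely_covered_def by (meson order_trans)
qed

lemma finitely_covered_trans: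
  assumes "L \<subseteq> carrier G" "finitely_covered H K" "finitely_covered K L"
  shows "finitely_covered H L"
proof -
  obtain C where C: "finite C" "C \<subseteq> carrier G" "H \<subseteq> (\<Union>c\<in>C. K #> c)"
    using assms(2) by (auto simp: finitely_covered_def)
  obtain D where D: "finite D" "D \<subseteq> carrier G" "K \<subseteq> (\<Union>c\<in>D. L #> c)"
    using assms(3) by (auto simp: finitely_covered_def)
  let ?E = "(\<lambda>(d, c). d \<otimes> c) ` (D \<times> C)"
  have "h \<in> (\<Union>e\<in>?E. L #> e)" if h: "h \<in> H" for h
  proof -
    obtain c k where c: "c \<in> C" "k \<in> K" "h = k \<otimes> c" using C(3) h unfolding r_coset_def by blast
    obtain d x where d: "d \<in> D" "x \<in> L" "k = x \<otimes> d" using D(3) c(2) unfolding r_coset_def by blast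
    have "x \<in> carrier G" "d \<in> carrier G" "c \<in> carrier G"
      using c(1) d(1,2) C(2) D(2) assms(1) by auto
    then have "h \<in> L #> (d \<otimes> c)"
      using rcosI[OF d(2) assms(1), of "d \<otimes> c"] by (simp add: c(3) d(3) m_assoc)
    moreover have "d \<otimes> c \<in> ?E" using c(1) d(1) by force
    ultimately show ?thesis by blast
  qed
  moreover have "finite ?E" "?E \<subseteq> carrier G" using C D by auto
  ultimately show ?thesis unfolding finitely_covered_def by blast
qed

lemma finitely_covered_conj_set:
  assumes "finitely_covered H K" "g \<in> carrier G" "K \<subseteq> carrier G"
  shows "finitely_covered (conj_set g H) (conj_set g K)"
proof -
  obtain C where C: "finite C" "C \<subseteq> carrier G" "H \<subseteq> (\<Union>c\<in>C. K #> c)"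
    using assms(1) by (auto simp: finitely_covered_def)
  let ?D = "(\<lambda>c. g \<otimes> c \<otimes> inv g) ` C"
  have "x \<in> (\<Union>d\<in>?D. conj_set g K #> d)" if x: "x \<in> conj_set g H" for x
  proof -
    obtain h where h: "h \<in> H" "x = g \<otimes> h \<otimes> inv g" using x by (auto simp: mem_conj_set)
    obtain c k where c: "c \<in> C" "k \<in> K" "h = k \<otimes> c" using C(3) h(1) unfolding r_coset_def by blast
    have kc: "k \<in> carrier G" "c \<in> carrier G" using c C assms(3) by auto
    then have "inv g \<otimes> (g \<otimes> (c \<otimes> inv g)) = c \<otimes> inv g"
      using assms(2) by (simp add: m_assoc[symmetric])
    then have "x = (g \<otimes> k \<otimes> inv g) \<otimes> (g \<otimes> c \<otimes> inv g)"
      using h c kc assms(2) by (simp add: m_assoc)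
    moreover have "g \<otimes> k \<otimes> inv g \<in> conj_set g K" using c by (auto simp: mem_conj_set)
    ultimately have "x \<in> conj_set g K #> (g \<otimes> c \<otimes> inv g)"
      using rcosI[of "g \<otimes> k \<otimes> inv g" "conj_set g K"] conj_set_subset[OF assms(2,3)] kc assms(2) by simp
    then show ?thesis using c(1) by blast
  qed
  moreover have "finite ?D" "?D \<subseteq> carrier G" using C assms by auto
  ultimately show ?thesis unfolding finitely_covered_def by blast
qed

text \<open>Pigeonhole: with one representative for each of the finitely many fibres of
  \<open>f\<close>, every \<open>h\<close> lies in the translate of \<open>K\<close> by the
  representative of its fibre. It serves with \<open>f\<close> a coset map and with \<open>f\<close>
  the action on a finite ball.\<close>

lemma finitely_coveredI:
  assumes "finite (f ` H)" "H \<subseteq> carrier G" "K \<subseteq> carrier G"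
    and "\<And>s t. s \<in> H \<Longrightarrow> t \<in> H \<Longrightarrow> f s = f t \<Longrightarrow> s \<otimes> inv t \<in> K"
  shows "finitely_covered H K"
proof -
  obtain C where C: "C \<subseteq> H" "finite C" "f ` H = f ` C"
    using finite_subset_image[OF assms(1) subset_refl] by metis
  have "h \<in> (\<Union>c\<in>C. K #> c)" if h: "h \<in> H" for h
  proof -
    obtain c where c: "c \<in> C" "f h = f c" using C(3) h by (metis imageE imageI)
    then have "h \<otimes> inv c \<in> K" using assms(4) C(1) h by auto
    moreover have "h = h \<otimes> inv c \<otimes> c"
      using h c(1) C(1) assms(2) by (simp add: m_assoc subset_iff)
    ultimately have "h \<in> K #> c"
      using rcosI[of "h \<otimes> inv c" K c] assms(2,3) c(1) C(1) by auto
    then show ?thesis using c(1) by blast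
  qed
  then show ?thesis using C assms(2) unfolding finitely_covered_def by blast
qed

text \<open>A coset of \<open>H \<inter> K\<close> in \<open>H\<close> is the trace on
  \<open>H\<close> of a coset of \<open>K\<close>, so finitely many covering translates leave only
  finitely many traces.\<close>

lemma finite_rcosets_iff:
  assumes "subgroup H G" "subgroup K G"
  shows "finite (rcosets\<^bsub>G\<lparr>carrier := H\<rparr>\<^esub> (H \<inter> K)) \<longleftrightarrow> finitely_covered H K"
proof -
  interpret H: subgroup H G by fact
  interpret K: subgroup K G by fact
  have eq: "rcosets\<^bsub>G\<lparr>carrier := H\<rparr>\<^esub> (H \<inter> K) = (\<lambda>a. (H \<inter> K) #> a) ` H"
    by (auto simp: RCOSETS_def r_coset_def)
  show ?thesis
  proof
    assume "finite (rcosets\<^bsub>G\<lparr>carrier := H\<rparr>\<^esub> (H \<inter> K))"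
    then show "finitely_covered H K"
      unfolding eq
    proof (rule finitely_coveredI)
      fix s t assume st: "s \<in> H" "t \<in> H" "(H \<inter> K) #> s = (H \<inter> K) #> t"
      then have "s \<in> (H \<inter> K) #> t"
        by (metis H.mem_carrier subgroups_Inter_pair assms rcos_self)
      then obtain k where "k \<in> K" "s = k \<otimes> t" by (auto simp: r_coset_def)
      then show "s \<otimes> inv t \<in> K" using st by (auto simp: m_assoc)
    qed auto
  next
    assume "finitely_covered H K"
    then obtain C where C: "finite C" "C \<subseteq> carrier G" "H \<subseteq> (\<Union>c\<in>C. K #> c)"
      by (auto simp: finitely_covered_def)
    have "(H \<inter> K) #> a \<in> (\<lambda>c. H \<inter> (K #> c)) ` C" if a: "a \<in> H" for a
    proof -
      obtain c where c: "c \<in> C" "a \<in> K #> c" using C(3) a by auto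
      then have "K #> a = K #> c" using repr_independence[OF c(2)] C(2) assms(2) by auto
      moreover have "(H \<inter> K) #> a = H \<inter> (K #> a)"
      proof (intro equalityI subsetI)
        fix x assume "x \<in> H \<inter> (K #> a)"
        then obtain k where k: "k \<in> K" "x = k \<otimes> a" "x \<in> H" by (auto simp: r_coset_def)
        then have "k = x \<otimes> inv a" using a by (auto simp: m_assoc)
        then have "k \<in> H" using k(3) a H.m_closed H.m_inv_closed by metis
        then show "x \<in> (H \<inter> K) #> a" using k by (auto simp: r_coset_def)
      qed (use a in \<open>auto simp: r_coset_def\<close>)
      ultimately show ?thesis using c by auto
    qed
    then show "finite (rcosets\<^bsub>G\<lparr>carrier := H\<rparr>\<^esub> (H \<inter> K))"
      unfolding eq using C(1) by (meson finite_imageI finite_subset image_subsetI)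
  qed
qed

text \<open>All coverings are taken in the ambient group, so \<open>M\<close> enters only through
  \<open>g \<in> M\<close>. This makes the commensurators of one \<open>S\<close> in different
  subgroups directly comparable.\<close>

lemma commensurator_iff:
  assumes "subgroup M G" "subgroup S G" "S \<subseteq> M"
  shows "g \<in> commensurator (G\<lparr>carrier := M\<rparr>) S \<longleftrightarrow>
    g \<in> M \<and> finitely_covered S (conj_set g S) \<and> finitely_covered (conj_set g S) S"
proof (cases "g \<in> M")
  case True
  then have g: "g \<in> carrier G" using assms(1) subgroup.subset by auto
  have K: "g <#\<^bsub>G\<lparr>carrier := M\<rparr>\<^esub> S #>\<^bsub>G\<lparr>carrier := M\<rparr>\<^esub> inv\<^bsub>G\<lparr>carrier := M\<rparr>\<^esub> g = conj_set g S"
    using m_inv_consistent[OF assms(1) True] unfolding conj_set_def l_coset_def r_coset_def by simp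
  note * = finite_rcosets_iff[OF assms(2) subgroup_conj_set[OF g assms(2)]]
    finite_rcosets_iff[OF subgroup_conj_set[OF g assms(2)] assms(2)]
  show ?thesis
    unfolding commensurator_def finite_index_def Let_def mem_Collect_eq K using True * by simp
qed (auto simp: commensurator_def)

lemma subgroup_commensurator:
  assumes M: "subgroup M G" and S: "subgroup S G" and "S \<subseteq> M"
  shows "subgroup (commensurator (G\<lparr>carrier := M\<rparr>) S) G"
proof -
  note iff = commensurator_iff[OF assms]
  note cM = subgroup.mem_carrier[OF M]
  have Sc: "S \<subseteq> carrier G" using S subgroup.subset by blast
  show ?thesis
  proof (rule subgroupI)
    show "commensurator (G\<lparr>carrier := M\<rparr>) S \<subseteq> carrier G" using iff cM by auto
    have "\<one> \<in> commensurator (G\<lparr>carrier := M\<rparr>) S"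
      using iff conj_set_one[OF Sc] finitely_covered_refl[OF Sc] subgroup.one_closed[OF M] by simp
    then show "commensurator (G\<lparr>carrier := M\<rparr>) S \<noteq> {}" by blast
  next
    fix g assume "g \<in> commensurator (G\<lparr>carrier := M\<rparr>) S"
    then have g: "g \<in> M" "finitely_covered S (conj_set g S)" "finitely_covered (conj_set g S) S"
      using iff by auto
    have gc: "g \<in> carrier G" using g cM by auto
    have eq: "conj_set (inv g) (conj_set g S) = S"
      using gc Sc by (simp add: conj_set_mult conj_set_one)
    show "inv g \<in> commensurator (G\<lparr>carrier := M\<rparr>) S"
      using iff subgroup.m_inv_closed[OF M g(1)]
        finitely_covered_conj_set[OF g(2) inv_closed[OF gc] conj_set_subset[OF gc Sc]]
        finitely_covered_conj_set[OF g(3) inv_closed[OF gc] Sc] unfolding eq by blast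
  next
    fix g h assume "g \<in> commensurator (G\<lparr>carrier := M\<rparr>) S" "h \<in> commensurator (G\<lparr>carrier := M\<rparr>) S"
    then have g: "g \<in> M" "finitely_covered S (conj_set g S)" "finitely_covered (conj_set g S) S"
      and h: "h \<in> M" "finitely_covered S (conj_set h S)" "finitely_covered (conj_set h S) S"
      using iff by auto
    have gc: "g \<in> carrier G" "h \<in> carrier G" using g h cM by auto
    have sub: "conj_set (g \<otimes> h) S \<subseteq> carrier G" using gc Sc by (simp add: conj_set_subset)
    \<comment> \<open>Conjugating the coverings for \<open>h\<close> by \<open>g\<close> shows that
      \<open>conj_set g S\<close> can serve as the middle term of both chains.\<close>
    have 1: "finitely_covered (conj_set g S) (conj_set (g \<otimes> h) S)"
      "finitely_covered (conj_set (g \<otimes> h) S) (conj_set g S)"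
      using finitely_covered_conj_set[OF h(2) gc(1) conj_set_subset[OF gc(2) Sc]]
        finitely_covered_conj_set[OF h(3) gc(1) Sc]
      unfolding conj_set_mult[OF gc Sc] by blast+
    show "g \<otimes> h \<in> commensurator (G\<lparr>carrier := M\<rparr>) S"
      unfolding iff
      using subgroup.m_closed[OF M g(1) h(1)] finitely_covered_trans[OF sub g(2) 1(1)]
        finitely_covered_trans[OF Sc 1(2) g(3)] by blast
  qed
qed

text \<open>One-sided inclusions suffice: the second one, conjugated back by \<open>g\<close>, puts
  \<open>W'\<close> inside \<open>conj_set g S\<close>, and the covering of \<open>S\<close> by
  \<open>W\<close>, conjugated by \<open>g\<close>, becomes one by a subset of
  \<open>S\<close>.\<close>

lemma commensuratorI:
  assumes "subgroup M G" "subgroup S G" "S \<subseteq> M" and g: "g \<in> M"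
    and W: "finitely_covered S W" "conj_set g W \<subseteq> S"
    and W': "finitely_covered S W'" "conj_set (inv g) W' \<subseteq> S"
    and sub: "W \<subseteq> carrier G" "W' \<subseteq> carrier G"
  shows "g \<in> commensurator (G\<lparr>carrier := M\<rparr>) S"
proof -
  have gc: "g \<in> carrier G" using g assms(1) subgroup.subset by blast
  have Sc: "S \<subseteq> carrier G" using assms(2) subgroup.subset by blast
  have "conj_set g (conj_set (inv g) W') \<subseteq> conj_set g S"
  proof
    fix x assume "x \<in> conj_set g (conj_set (inv g) W')"
    then obtain h where "h \<in> conj_set (inv g) W'" "x = g \<otimes> h \<otimes> inv g"
      by (auto simp: mem_conj_set)
    then show "x \<in> conj_set g S" using W'(2) by (subst mem_conj_set) blast
  qed
  then have "W' \<subseteq> conj_set g S" using gc sub by (simp add: conj_set_mult conj_set_one)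
  then have "finitely_covered S (conj_set g S)" using W'(1) finitely_covered_mono by blast
  moreover have "finitely_covered (conj_set g S) S"
    using finitely_covered_conj_set[OF W(1) gc sub(1)] W(2) finitely_covered_mono by blast
  ultimately show ?thesis using commensurator_iff[OF assms(1-3)] g by blast
qed


lemma coset_div_in:
  assumes "subgroup H G" "a \<in> carrier G" "f \<in> H #> a" "f' \<in> H #> a"
  shows "f' \<otimes> inv f \<in> H"
proof -
  interpret H: subgroup H G by fact
  obtain h h' where h: "h \<in> H" "f = h \<otimes> a" "h' \<in> H" "f' = h' \<otimes> a"
    using assms(3,4) by (auto simp: r_coset_def)
  have "a \<otimes> (inv a \<otimes> inv h) = inv h" using assms(2) h by (simp add: m_assoc[symmetric])
  then have "f' \<otimes> inv f = h' \<otimes> inv h" using assms(2) h by (simp add: inv_mult_group m_assoc)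
  then show ?thesis using h by simp
qed

text \<open>Since \<open>conj_set a H = H\<close> is an equality of sets, conjugation by
  \<open>a\<close> can also be undone inside \<open>H\<close>, and the factor from \<open>H\<close>
  in \<open>f\<close> is absorbed. Both directions are needed because \<open>g\<close> and its
  inverse are treated separately.\<close>

lemma coset_normalizes:
  assumes "subgroup H G" "a \<in> carrier G" "conj_set a H = H" "f \<in> H #> a" "h \<in> H"
  shows "f \<otimes> h \<otimes> inv f \<in> H" "inv f \<otimes> h \<otimes> f \<in> H"
proof -
  interpret H: subgroup H G by fact
  obtain k where k: "k \<in> H" "f = k \<otimes> a" using assms(4) by (auto simp: r_coset_def)
  have "a \<otimes> h \<otimes> inv a \<in> conj_set a H" unfolding mem_conj_set using assms(5) by blast
  then have "a \<otimes> h \<otimes> inv a \<in> H" using assms(3) by simp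
  then have "k \<otimes> (a \<otimes> h \<otimes> inv a) \<otimes> inv k \<in> H" using k by simp
  then show "f \<otimes> h \<otimes> inv f \<in> H" using k assms(2,5) by (simp add: inv_mult_group m_assoc)
  have "inv k \<otimes> h \<otimes> k \<in> conj_set a H" using k assms(3,5) by simp
  then obtain h' where h': "h' \<in> H" "inv k \<otimes> h \<otimes> k = a \<otimes> h' \<otimes> inv a"
    by (auto simp: mem_conj_set)
  have "inv f \<otimes> h \<otimes> f = inv a \<otimes> (inv k \<otimes> h \<otimes> k) \<otimes> a"
    using k assms(2,5) by (simp add: inv_mult_group m_assoc)
  also have "\<dots> = inv a \<otimes> (a \<otimes> h')"
    unfolding h'(2) using h'(1) assms(2) by (simp add: m_assoc)
  also have "\<dots> = h'" using h'(1) assms(2) by (simp add: m_assoc[symmetric])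
  finally show "inv f \<otimes> h \<otimes> f \<in> H" using h'(1) by simp
qed

end

section \<open>Words in a legally colored tree\<close>

locale colored_tree =
  fixes T :: "('v, 'e) pre_digraph" and arev :: "'e \<Rightarrow> 'e" and l :: "'e \<Rightarrow> 'c" and \<Omega> :: "'c set"
  assumes serre_tree: "serre_tree T arev"
    and coloring: "legal_coloring T arev \<Omega> l"
    and finite_colors: "finite \<Omega>"
begin

sublocale bidirected_digraph T arev
  using serre_tree by (simp add: serre_tree_def)

text \<open>The inverse of the coloring at \<open>x\<close>, in the same form as in
  \<open>local_action\<close>, so that unfolding both reads \<sigma>(g, x) as the color of the image
  of \<open>edge x c\<close>.\<close>

definition edge :: "'v \<Rightarrow> 'c \<Rightarrow> 'e" where
  "edge x c = inv_into (out_arcs T x) l c"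

definition nbr :: "'v \<Rightarrow> 'c \<Rightarrow> 'v" where
  "nbr x c = head T (edge x c)"

text \<open>Words are read from right to left: the last letter is the color of the first arc.\<close>

definition walk :: "'v \<Rightarrow> 'c list \<Rightarrow> 'v" where
  "walk x w = foldr (\<lambda>c y. nbr y c) w x"

text \<open>Both orientations of an edge have the same color, so a repeated letter is a backtrack.
  These words are the normal forms in the free product of groups of order two indexed by
  \<open>\<Omega>\<close>.\<close>

definition reduced_words :: "'c list set" where
  "reduced_words = {w. set w \<subseteq> \<Omega> \<and> distinct_adj w}"

text \<open>Coordinates of \<open>y\<close> seen from \<open>x\<close>, whose length is the
  distance. The description is justified by \<open>ex_reduced_walk\<close> and
  \<open>reduced_walk_inj\<close>.\<close>

definition address :: "'v \<Rightarrow> 'v \<Rightarrow> 'c list" where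
  "address x y = (THE w. w \<in> reduced_words \<and> walk x w = y)"

lemma bij_betw_coloring: "x \<in> verts T \<Longrightarrow> bij_betw l (out_arcs T x) \<Omega>"
  using coloring by (simp add: legal_coloring_def)

lemma color_in: "e \<in> arcs T \<Longrightarrow> l e \<in> \<Omega>"
  and color_arev: "e \<in> arcs T \<Longrightarrow> l (arev e) = l e"
  using coloring by (auto simp: legal_coloring_def)

lemma edge_in_out_arcs:
  assumes "x \<in> verts T" "c \<in> \<Omega>"
  shows "edge x c \<in> out_arcs T x"
  using assms bij_betw_coloring[OF assms(1)] unfolding edge_def
  by (auto simp: bij_betw_def intro!: inv_into_into simp del: in_out_arcs_conv)

lemma edge_simps [simp]:
  assumes "x \<in> verts T" "c \<in> \<Omega>"
  shows "edge x c \<in> arcs T" "tail T (edge x c) = x" "l (edge x c) = c"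
  using edge_in_out_arcs[OF assms] bij_betw_coloring[OF assms(1)] assms(2)
  by (auto simp: edge_def bij_betw_def f_inv_into_f)

lemma edge_eq [simp]:
  assumes "e \<in> arcs T"
  shows "edge (tail T e) (l e) = e"
  using bij_betw_coloring[of "tail T e"] assms unfolding edge_def bij_betw_def
  by (auto intro!: inv_into_f_f)

lemma nbr_in_verts [simp]: "x \<in> verts T \<Longrightarrow> c \<in> \<Omega> \<Longrightarrow> nbr x c \<in> verts T"
  by (simp add: nbr_def)

lemma arev_edge:
  assumes "x \<in> verts T" "c \<in> \<Omega>"
  shows "arev (edge x c) = edge (nbr x c) c"
  using edge_eq[of "arev (edge x c)"] assms by (simp add: nbr_def color_arev)

lemma nbr_nbr [simp]: "x \<in> verts T \<Longrightarrow> c \<in> \<Omega> \<Longrightarrow> nbr (nbr x c) c = x"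
  unfolding nbr_def[of "nbr x c"] by (simp add: arev_edge[symmetric])

lemma adjacent_iff_nbr:
  "x \<rightarrow>\<^bsub>T\<^esub> y \<longleftrightarrow> x \<in> verts T \<and> (\<exists>c\<in>\<Omega>. y = nbr x c)"
proof
  assume "x \<rightarrow>\<^bsub>T\<^esub> y"
  then obtain e where "e \<in> arcs T" "tail T e = x" "head T e = y" by auto
  then show "x \<in> verts T \<and> (\<exists>c\<in>\<Omega>. y = nbr x c)"
    using edge_eq[of e] by (auto simp: nbr_def color_in intro!: bexI[of _ "l e"])
next
  assume "x \<in> verts T \<and> (\<exists>c\<in>\<Omega>. y = nbr x c)"
  then obtain c where "x \<in> verts T" "c \<in> \<Omega>" "y = nbr x c" by auto
  then show "x \<rightarrow>\<^bsub>T\<^esub> y" using in_arcs_imp_in_arcs_ends[of "edge x c"] by (simp add: nbr_def)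
qed

lemma walk_simps [simp]:
  "walk x [] = x" "walk x (c # w) = nbr (walk x w) c"
  by (simp_all add: walk_def)

lemma walk_append: "walk x (v @ w) = walk (walk x w) v"
  by (simp add: walk_def)

lemma walk_in_verts [simp]: "x \<in> verts T \<Longrightarrow> set w \<subseteq> \<Omega> \<Longrightarrow> walk x w \<in> verts T"
  by (induction w) auto

lemma walk_rev: "x \<in> verts T \<Longrightarrow> set w \<subseteq> \<Omega> \<Longrightarrow> walk (walk x w) (rev w) = x"
  by (induction w) (auto simp: walk_append)

section \<open>Closed walks in a tree backtrack\<close>

lemma cas_append: "cas u (p @ q) v \<longleftrightarrow> (\<exists>w. cas u p w \<and> cas w q v)"
  by (induction p arbitrary: u) auto

lemma cas_head_last: "cas u p v \<Longrightarrow> p \<noteq> [] \<Longrightarrow> head T (last p) = v"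
  by (induction p arbitrary: u) (auto split: if_splits)

lemma awalk_verts_cas: "cas u p v \<Longrightarrow> awalk_verts u p = u # map (head T) p"
  by (induction p arbitrary: u) auto

text \<open>
  A closed walk without backtracking contains a cycle without backtracking; in such a cycle an arc
  and its reverse could only occur next to each other.
\<close>

lemma cycle_without_backtracking:
  assumes p: "awalk u p u" "p \<noteq> []" and dist: "distinct (map (head T) p)"
    and nb: "successively (\<lambda>e f. f \<noteq> arev e) p"
  shows "circuit T arev p"
proof -
  have cas: "cas u p u" and arcs: "set p \<subseteq> arcs T" using p by (auto simp: awalk_def)
  \<comment> \<open>The arc before \<open>arev e\<close> ends where \<open>e\<close> ends,
    contradicting distinct heads. This includes the case that \<open>e\<close> is the first and
    \<open>arev e\<close> the last arc, so the linear condition \<open>successively\<close> suffices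
    although the walk is closed.\<close>
  have False if split: "p = p1 @ e # p2 @ arev e # p3" for p1 e p2 p3
  proof -
    have e: "e \<in> arcs T" using arcs split by auto
    have "p2 \<noteq> []" using nb split by (auto simp: successively_append_iff)
    obtain w w' where w: "cas u p1 w" "tail T e = w" "cas (head T e) p2 w'" "tail T (arev e) = w'"
      "cas (head T (arev e)) p3 u"
      using cas unfolding split by (auto simp: cas_append)
    have "head T (last p2) = head T e"
      using cas_head_last[OF w(3) \<open>p2 \<noteq> []\<close>] w(4) e by simp
    moreover have "head T (last p2) \<noteq> head T e"
      using dist \<open>p2 \<noteq> []\<close> unfolding split by (auto dest!: last_in_set) (metis imageI)
    ultimately show False by simp
  qed
  moreover have "\<exists>p1 f p2 p3. p = p1 @ f # p2 @ arev f # p3" if e: "e \<in> set p" "arev e \<in> set p" for e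
  proof -
    obtain p1 q where q: "p = p1 @ e # q" using \<open>e \<in> set p\<close> by (meson split_list)
    have "arev e \<noteq> e" using arcs \<open>e \<in> set p\<close> by (auto simp: arev_neq)
    then consider "arev e \<in> set q" | "arev e \<in> set p1" using e(2) q by auto
    then show ?thesis
    proof cases
      case 1
      then show ?thesis using q by (metis split_list)
    next
      case 2
      then obtain r s where "p1 = r @ arev e # s" by (meson split_list)
      then have "p = r @ arev e # s @ arev (arev e) # q" using q by simp
      then show ?thesis by blast
    qed
  qed
  ultimately have "\<forall>e\<in>set p. arev e \<notin> set p" by blast
  moreover have "cycle p"
    unfolding cycle_def using p dist awalk_verts_cas[OF cas] by (intro exI[of _ u]) simp
  ultimately show ?thesis by (simp add: circuit_def)
qed

text \<open>If no head is repeated, the walk is a circuit. Otherwise the piece between two visits of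
  a vertex is a shorter closed walk which, being contiguous, does not backtrack either.\<close>

lemma no_closed_walk_without_backtracking:
  assumes "awalk u p u" "successively (\<lambda>e f. f \<noteq> arev e) p"
  shows "p = []"
  using assms
proof (induction "length p" arbitrary: u p rule: less_induct)
  case less
  show ?case
  proof (rule ccontr)
    assume "p \<noteq> []"
    have "cas u p u" using less.prems by (auto simp: awalk_def)
    have "\<not> distinct (map (head T) p)"
      using cycle_without_backtracking[OF less.prems(1) \<open>p \<noteq> []\<close> _ less.prems(2)] serre_tree
      by (auto simp: serre_tree_def)
    then obtain xs ys zs y where "map (head T) p = xs @ [y] @ ys @ [y] @ zs"
      using not_distinct_decomp by blast
    then obtain p1 q p2 p3 e f where "p = p1 @ e # q" "q = p2 @ f # p3"
      and p: "head T e = y" "head T f = y"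
      by (simp add: map_eq_append_conv map_eq_Cons_conv append_eq_map_conv Cons_eq_map_conv) metis
    then have p: "p = p1 @ e # p2 @ f # p3" "head T e = y" "head T f = y" by auto
    \<comment> \<open>The piece starts after \<open>e\<close>, which makes it shorter, and includes
      \<open>f\<close>, which keeps it nonempty.\<close>
    then have "cas y (p2 @ [f]) y"
      using \<open>cas u p u\<close> by (auto simp: cas_append)
    moreover have "y \<in> verts T" "set (p2 @ [f]) \<subseteq> arcs T"
      using p less.prems(1) by (auto simp: awalk_def)
    ultimately have "awalk y (p2 @ [f]) y" by (simp add: awalk_def)
    moreover have "successively (\<lambda>e f. f \<noteq> arev e) (p2 @ [f])"
      using less.prems(2) unfolding p by (auto simp: successively_append_iff successively_Cons)
    moreover have "length (p2 @ [f]) < length p" using p by simp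
    ultimately show False using less.hyps by blast
  qed
qed

primrec edges :: "'v \<Rightarrow> 'c list \<Rightarrow> 'e list" where
  "edges x [] = []"
| "edges x (c # w) = edges x w @ [edge (walk x w) c]"

lemma awalk_edges:
  assumes "x \<in> verts T" "set w \<subseteq> \<Omega>"
  shows "awalk x (edges x w) (walk x w)"
proof -
  have "cas x (edges x w) (walk x w) \<and> set (edges x w) \<subseteq> arcs T"
    using assms by (induction w) (auto simp: cas_append nbr_def simp del: cas_append_iff)
  then show ?thesis using assms by (simp add: awalk_def)
qed

text \<open>An arc and its reverse share their color, whereas adjacent letters of a reduced word
  differ.\<close>

lemma edges_without_backtracking:
  assumes "x \<in> verts T" "w \<in> reduced_words"
  shows "successively (\<lambda>e f. f \<noteq> arev e) (edges x w)"
  using assms(2)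
proof (induction w rule: induct_list012)
  case (3 c c' w)
  have y: "walk x w \<in> verts T" "c \<in> \<Omega>" "c' \<in> \<Omega>" and "c \<noteq> c'"
    using 3(3) assms(1) by (auto simp: reduced_words_def)
  then have "edge (nbr (walk x w) c') c \<noteq> arev (edge (walk x w) c')"
    using edge_simps(3)[of "nbr (walk x w) c'"] by (metis arev_edge nbr_in_verts)
  then show ?case using 3 by (auto simp: successively_append_iff reduced_words_def)
qed auto

lemma reduced_closed_walk:
  assumes "x \<in> verts T" "w \<in> reduced_words" "walk x w = x"
  shows "w = []"
proof -
  have "edges x w = []"
    using no_closed_walk_without_backtracking edges_without_backtracking[OF assms(1,2)]
      awalk_edges[of x w] assms by (auto simp: reduced_words_def)
  then show ?thesis by (cases w) auto
qed

text \<open>Induction on the first step, which is the last letter. If the first colors agree, the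
  base point moves along the common arc. Otherwise going back along \<open>v\<close> and then out
  along \<open>w\<close> is a reduced closed walk, because the letters meeting at \<open>x\<close>
  differ.\<close>

lemma reduced_walk_inj:
  assumes "x \<in> verts T" "v \<in> reduced_words" "w \<in> reduced_words" "walk x v = walk x w"
  shows "v = w"
  using assms
proof (induction v arbitrary: x w rule: rev_induct)
  case Nil
  then show ?case using reduced_closed_walk by (metis walk_simps(1))
next
  case (snoc c v)
  have v: "v \<in> reduced_words" "c \<in> \<Omega>" using snoc.prems by (auto simp: reduced_words_def)
  show ?case
  proof (cases w rule: rev_cases)
    case Nil
    then show ?thesis using reduced_closed_walk snoc.prems by (metis walk_simps(1))
  next
    case (snoc w' c')
    have w': "w' \<in> reduced_words" "c' \<in> \<Omega>" using snoc.prems(3) snoc by (auto simp: reduced_words_def)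
    show ?thesis
    proof (cases "c = c'")
      case True
      then have "walk (nbr x c) v = walk (nbr x c) w'"
        using snoc.prems(4) snoc by (simp add: walk_append)
      then show ?thesis using snoc.IH[of "nbr x c" w'] snoc.prems(1) v w' snoc True by simp
    next
      case False
      let ?u = "rev (v @ [c])"
      have sets: "set (v @ [c]) \<subseteq> \<Omega>" "set w \<subseteq> \<Omega>"
        using snoc.prems by (auto simp: reduced_words_def)
      have "distinct_adj ?u" "distinct_adj w"
        using snoc.prems by (simp_all add: reduced_words_def del: rev_append)
      moreover have "last w \<noteq> hd ?u" using False snoc by simp
      ultimately have "w @ ?u \<in> reduced_words"
        using sets by (auto simp: reduced_words_def distinct_adj_append_iff[of w] simp del: rev_append)
      moreover have "walk (walk x (v @ [c])) (w @ ?u) = walk x (v @ [c])"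
        unfolding walk_append[of _ w] walk_rev[OF snoc.prems(1) sets(1)] using snoc.prems(4) by simp
      moreover have "walk x (v @ [c]) \<in> verts T"
        using snoc.prems by (auto simp: reduced_words_def)
      ultimately have "w @ ?u = []" using reduced_closed_walk by blast
      then show ?thesis by simp
    qed
  qed
qed

text \<open>Connectivity yields some walk; one further arc either keeps the word reduced or cancels
  its most recent letter, the head of the list.\<close>

lemma ex_reduced_walk:
  assumes "x \<in> verts T" "y \<in> verts T"
  shows "\<exists>w\<in>reduced_words. walk x w = y"
proof -
  have "symmetric T"
    unfolding symmetric_conv by (metis arev_in_arcs head_arev tail_arev)
  then have "strongly_connected T"
    using serre_tree symmetric_connected_imp_strongly_connected by (auto simp: serre_tree_def)
  then have "x \<rightarrow>\<^sup>*\<^bsub>T\<^esub> y" using assms by (auto simp: strongly_connected_def)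
  then show ?thesis
  proof (induction rule: reachable_induct)
    case base
    then show ?case by (intro bexI[of _ "[]"]) (auto simp: reduced_words_def)
  next
    case (step y z)
    then obtain w c where w: "w \<in> reduced_words" "walk x w = y" "c \<in> \<Omega>" "z = nbr y c"
      by (auto simp: adjacent_iff_nbr)
    show ?case
    proof (cases "w \<noteq> [] \<and> hd w = c")
      case True
      then have "w = c # tl w" by (metis list.collapse)
      then have tl: "tl w \<in> reduced_words"
        using w(1) by (metis (no_types, lifting) distinct_adj_ConsD mem_Collect_eq reduced_words_def set_subset_Cons subset_trans)
      then have "nbr (walk x (c # tl w)) c = walk x (tl w)"
        using assms(1) w(3) by (simp add: reduced_words_def)
      then have "walk x (tl w) = z" using w \<open>w = c # tl w\<close> by metis
      then show ?thesis using tl by blast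
    next
      case False
      then have "c # w \<in> reduced_words" using w by (auto simp: reduced_words_def distinct_adj_Cons)
      then show ?thesis using w by (auto intro!: bexI[of _ "c # w"])
    qed
  qed
qed

section \<open>Addresses and distances\<close>

lemma address_eqI:
  assumes "x \<in> verts T" "w \<in> reduced_words" "walk x w = y"
  shows "address x y = w"
  unfolding address_def using assms reduced_walk_inj by blast

lemma
  assumes "x \<in> verts T" "y \<in> verts T"
  shows address_reduced: "address x y \<in> reduced_words"
    and walk_address: "walk x (address x y) = y"
proof -
  obtain w where "w \<in> reduced_words" "walk x w = y" using ex_reduced_walk[OF assms] by blast
  then show "address x y \<in> reduced_words" "walk x (address x y) = y"
    using address_eqI[OF assms(1)] by simp_all
qed

lemma address_self [simp]: "x \<in> verts T \<Longrightarrow> address x x = []"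
  by (rule address_eqI) (auto simp: reduced_words_def)

text \<open>Every arc leads one step away from \<open>x\<close> or one step back. Swapping
  \<open>y\<close> and \<open>nbr y c\<close> exchanges the cases, so a statement symmetric in the
  two ends of an edge has to be checked only in the outward direction.\<close>

lemma nbr_address_cases:
  assumes "x \<in> verts T" "y \<in> verts T" "c \<in> \<Omega>"
  obtains "address x y = c # address x (nbr y c)" | "address x (nbr y c) = c # address x y"
proof (cases "\<exists>w. address x y = c # w")
  case True
  then obtain w where w: "address x y = c # w" by blast
  then have red: "w \<in> reduced_words"
    using address_reduced[OF assms(1,2)] by (auto simp: reduced_words_def dest: distinct_adj_ConsD)
  have "nbr y c = walk x w"
    using walk_address[OF assms(1,2)] w red assms by (auto simp: reduced_words_def)
  then have "address x (nbr y c) = w" using address_eqI[OF assms(1) red] by simp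
  then show ?thesis using that w by simp
next
  case False
  then have "c # address x y \<in> reduced_words"
    using address_reduced[OF assms(1,2)] assms(3)
    by (cases "address x y") (auto simp: reduced_words_def)
  then have "address x (nbr y c) = c # address x y"
    using address_eqI[OF assms(1)] walk_address[OF assms(1,2)] by simp
  then show ?thesis using that by simp
qed

lemma length_address_walk_le:
  assumes "x \<in> verts T" "set w \<subseteq> \<Omega>"
  shows "length (address x (walk x w)) \<le> length w"
  using assms(2)
proof (induction w)
  case (Cons c w)
  then have "walk x w \<in> verts T" "c \<in> \<Omega>" using assms(1) by auto
  then show ?case
    using Cons by (cases rule: nbr_address_cases[OF assms(1), of "walk x w" c]) auto
qed (use assms in simp)

lemma nbr_inj:
  assumes "x \<in> verts T" "c \<in> \<Omega>" "c' \<in> \<Omega>" "nbr x c = nbr x c'"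
  shows "c = c'"
  using reduced_walk_inj[of x "[c]" "[c']"] assms by (simp add: reduced_words_def)

section \<open>Automorphisms and local actions\<close>

abbreviation Aut :: "(('v \<Rightarrow> 'v) \<times> ('e \<Rightarrow> 'e)) monoid" where
  "Aut \<equiv> aut_group T arev"

abbreviation Sym :: "('c \<Rightarrow> 'c) monoid" where
  "Sym \<equiv> BijGroup \<Omega>"

abbreviation \<sigma> :: "('v \<Rightarrow> 'v) \<times> ('e \<Rightarrow> 'e) \<Rightarrow> 'v \<Rightarrow> 'c \<Rightarrow> 'c" where
  "\<sigma> \<equiv> local_action T \<Omega> l"

sublocale Sym: group Sym
  by (rule group_BijGroup)

lemma carrier_Aut:
  "g \<in> carrier Aut \<longleftrightarrow> fst g \<in> Bij (verts T) \<and> snd g \<in> Bij (arcs T) \<and>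
    (\<forall>e\<in>arcs T. tail T (snd g e) = fst g (tail T e) \<and> head T (snd g e) = fst g (head T e) \<and>
      snd g (arev e) = arev (snd g e))"
  by (auto simp: aut_group_def mem_Times_iff)

lemma subgroup_carrier_Aut: "subgroup (carrier Aut) (BijGroup (verts T) \<times>\<times> BijGroup (arcs T))"
proof -
  let ?P = "BijGroup (verts T) \<times>\<times> BijGroup (arcs T)"
  interpret P: group ?P by (intro DirProd_group group_BijGroup)
  show ?thesis
  proof (rule P.subgroupI)
    show "carrier Aut \<subseteq> carrier ?P"
      by (auto simp: carrier_Aut carrier_BijGroup mem_Times_iff)
    have "\<one>\<^bsub>?P\<^esub> \<in> carrier Aut"
      by (auto simp: carrier_Aut BijGroup_def id_Bij)
    then show "carrier Aut \<noteq> {}" by blast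
  next
    fix g h assume "g \<in> carrier Aut" "h \<in> carrier Aut"
    then show "g \<otimes>\<^bsub>?P\<^esub> h \<in> carrier Aut"
      by (auto simp: carrier_Aut mult_DirProd' mult_BijGroup compose_Bij compose_eq Bij_mem)
  next
    fix g assume g: "g \<in> carrier Aut"
    then have bij: "fst g \<in> Bij (verts T)" "snd g \<in> Bij (arcs T)" by (auto simp: carrier_Aut)
    have inv: "inv\<^bsub>?P\<^esub> g = (\<lambda>x\<in>verts T. inv_into (verts T) (fst g) x, \<lambda>x\<in>arcs T. inv_into (arcs T) (snd g) x)"
      using bij inv_DirProd[of "BijGroup (verts T)" "BijGroup (arcs T)" "fst g" "snd g"]
      by (simp add: group_BijGroup carrier_BijGroup inv_BijGroup)
    have injV: "inv_into (verts T) (fst g) (fst g x) = x" if "x \<in> verts T" for x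
      using bij that by (simp add: Bij_def bij_betw_def)
    have injE: "inv_into (arcs T) (snd g) (snd g e) = e" if "e \<in> arcs T" for e
      using bij that by (simp add: Bij_def bij_betw_def)
    have "tail T (snd (inv\<^bsub>?P\<^esub> g) e) = fst (inv\<^bsub>?P\<^esub> g) (tail T e) \<and>
        head T (snd (inv\<^bsub>?P\<^esub> g) e) = fst (inv\<^bsub>?P\<^esub> g) (head T e) \<and>
        snd (inv\<^bsub>?P\<^esub> g) (arev e) = arev (snd (inv\<^bsub>?P\<^esub> g) e)" if e: "e \<in> arcs T" for e
    proof -
      obtain f where f: "f \<in> arcs T" "e = snd g f" using Bij_surj[OF bij(2) e] by auto
      have "tail T e = fst g (tail T f)" "head T e = fst g (head T f)" "arev e = snd g (arev f)"
        using g f by (auto simp: carrier_Aut)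
      moreover have "arev e \<in> arcs T" "tail T e \<in> verts T" "head T e \<in> verts T" using e by auto
      moreover have "arev f \<in> arcs T" "tail T f \<in> verts T" "head T f \<in> verts T" using f by auto
      ultimately show ?thesis
        using f e unfolding inv by (simp add: injV injE)
    qed
    then show "inv\<^bsub>?P\<^esub> g \<in> carrier Aut"
      unfolding carrier_Aut using bij by (simp add: inv restrict_inv_into_Bij del: restrict_apply)
  qed
qed

lemma group_Aut: "group Aut"
proof -
  have "Aut = (BijGroup (verts T) \<times>\<times> BijGroup (arcs T))\<lparr>carrier := carrier Aut\<rparr>"
    by (simp add: aut_group_def)
  then show ?thesis
    using subgroup.subgroup_is_group[OF subgroup_carrier_Aut] DirProd_group group_BijGroup by metis
qed

sublocale Aut: group Aut
  by (rule group_Aut)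

lemma fst_in_verts [simp]: "g \<in> carrier Aut \<Longrightarrow> x \<in> verts T \<Longrightarrow> fst g x \<in> verts T"
  by (auto simp: carrier_Aut Bij_mem)

lemma snd_in_arcs [simp]: "g \<in> carrier Aut \<Longrightarrow> e \<in> arcs T \<Longrightarrow> snd g e \<in> arcs T"
  by (auto simp: carrier_Aut Bij_mem)

lemma Aut_mult:
  assumes "g \<in> carrier Aut" "h \<in> carrier Aut"
  shows "x \<in> verts T \<Longrightarrow> fst (g \<otimes>\<^bsub>Aut\<^esub> h) x = fst g (fst h x)"
    and "e \<in> arcs T \<Longrightarrow> snd (g \<otimes>\<^bsub>Aut\<^esub> h) e = snd g (snd h e)"
proof -
  have "g \<otimes>\<^bsub>Aut\<^esub> h = (compose (verts T) (fst g) (fst h), compose (arcs T) (snd g) (snd h))"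
    using assms by (auto simp: carrier_Aut aut_group_def mult_DirProd' mult_BijGroup)
  then show "x \<in> verts T \<Longrightarrow> fst (g \<otimes>\<^bsub>Aut\<^esub> h) x = fst g (fst h x)"
    "e \<in> arcs T \<Longrightarrow> snd (g \<otimes>\<^bsub>Aut\<^esub> h) e = snd g (snd h e)"
    by (simp_all add: compose_eq)
qed

lemma Aut_one:
  shows "x \<in> verts T \<Longrightarrow> fst \<one>\<^bsub>Aut\<^esub> x = x" and "e \<in> arcs T \<Longrightarrow> snd \<one>\<^bsub>Aut\<^esub> e = e"
  by (simp_all add: aut_group_def BijGroup_def)

lemma fst_inv [simp]:
  assumes "g \<in> carrier Aut" "x \<in> verts T"
  shows "fst (inv\<^bsub>Aut\<^esub> g) (fst g x) = x" "fst g (fst (inv\<^bsub>Aut\<^esub> g) x) = x"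
  using Aut_mult(1)[of "inv\<^bsub>Aut\<^esub> g" g x] Aut_mult(1)[of g "inv\<^bsub>Aut\<^esub> g" x] assms Aut_one(1)
  by simp_all

lemma snd_edge:
  assumes "g \<in> carrier Aut" "x \<in> verts T" "c \<in> \<Omega>"
  shows "snd g (edge x c) = edge (fst g x) (\<sigma> g x c)"
proof -
  have "tail T (snd g (edge x c)) = fst g x"
    using assms by (simp add: carrier_Aut)
  then show ?thesis
    using edge_eq[of "snd g (edge x c)"] assms by (simp add: local_action_def edge_def[symmetric])
qed

lemma local_action_Bij:
  assumes "g \<in> carrier Aut" "x \<in> verts T"
  shows "\<sigma> g x \<in> Bij \<Omega>"
proof -
  have "\<sigma> g x c \<in> \<Omega>" if "c \<in> \<Omega>" for c
    using assms that by (simp add: local_action_def edge_def[symmetric] color_in)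
  moreover have "inj_on (\<sigma> g x) \<Omega>"
  proof (rule inj_onI)
    fix c c' assume c: "c \<in> \<Omega>" "c' \<in> \<Omega>" "\<sigma> g x c = \<sigma> g x c'"
    then have "snd g (edge x c) = snd g (edge x c')" using assms snd_edge by simp
    then have "edge x c = edge x c'"
      using Bij_inj[of "snd g" "arcs T"] assms c by (auto simp: carrier_Aut)
    then show "c = c'" using edge_simps(3) assms c by metis
  qed
  ultimately have "bij_betw (\<sigma> g x) \<Omega> \<Omega>"
    using endo_inj_surj[OF finite_colors] by (auto simp: bij_betw_def image_subset_iff)
  then show ?thesis by (simp add: Bij_def local_action_def)
qed

lemma local_action_in [simp]:
  "g \<in> carrier Aut \<Longrightarrow> x \<in> verts T \<Longrightarrow> c \<in> \<Omega> \<Longrightarrow> \<sigma> g x c \<in> \<Omega>"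
  using local_action_Bij Bij_mem by metis

lemma fst_nbr:
  assumes "g \<in> carrier Aut" "x \<in> verts T" "c \<in> \<Omega>"
  shows "fst g (nbr x c) = nbr (fst g x) (\<sigma> g x c)"
proof -
  have "fst g (nbr x c) = head T (snd g (edge x c))"
    using assms by (simp add: nbr_def carrier_Aut)
  then show ?thesis using assms by (simp add: snd_edge nbr_def)
qed

text \<open>\<open>g\<close> commutes with reversal, which preserves colors. This agreement along
  edges is the only constraint on a family of local actions; the converse is
  \<open>ex_automorphism\<close>.\<close>

lemma local_action_nbr:
  assumes "g \<in> carrier Aut" "x \<in> verts T" "c \<in> \<Omega>"
  shows "\<sigma> g (nbr x c) c = \<sigma> g x c"
proof -
  have "snd g (arev (edge x c)) = arev (snd g (edge x c))"
    using assms by (simp add: carrier_Aut)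
  then have "edge (fst g (nbr x c)) (\<sigma> g (nbr x c) c) = edge (nbr (fst g x) (\<sigma> g x c)) (\<sigma> g x c)"
    using assms by (simp add: arev_edge snd_edge)
  then show ?thesis
    using edge_simps(3) assms fst_nbr by (metis local_action_in nbr_in_verts fst_in_verts)
qed

lemma local_action_mult:
  assumes "g \<in> carrier Aut" "h \<in> carrier Aut" "x \<in> verts T"
  shows "\<sigma> (g \<otimes>\<^bsub>Aut\<^esub> h) x = \<sigma> g (fst h x) \<otimes>\<^bsub>Sym\<^esub> \<sigma> h x"
proof -
  have "\<sigma> (g \<otimes>\<^bsub>Aut\<^esub> h) x c = \<sigma> g (fst h x) (\<sigma> h x c)" if "c \<in> \<Omega>" for c
  proof -
    have "\<sigma> (g \<otimes>\<^bsub>Aut\<^esub> h) x c = l (snd g (snd h (edge x c)))"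
      using that assms by (simp add: local_action_def edge_def[symmetric] Aut_mult)
    also have "\<dots> = \<sigma> g (fst h x) (\<sigma> h x c)"
      using that assms by (simp add: snd_edge)
    finally show ?thesis .
  qed
  then show ?thesis
    using local_action_Bij assms
    by (auto simp: mult_BijGroup compose_def local_action_def[of _ _ _ "g \<otimes>\<^bsub>Aut\<^esub> h"] fun_eq_iff)
qed

lemma local_action_one: "x \<in> verts T \<Longrightarrow> \<sigma> \<one>\<^bsub>Aut\<^esub> x = \<one>\<^bsub>Sym\<^esub>"
  by (auto simp: local_action_def edge_def[symmetric] Aut_one BijGroup_def fun_eq_iff)

lemma local_action_inv:
  assumes "g \<in> carrier Aut" "x \<in> verts T"
  shows "\<sigma> (inv\<^bsub>Aut\<^esub> g) x = inv\<^bsub>Sym\<^esub> (\<sigma> g (fst (inv\<^bsub>Aut\<^esub> g) x))"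
proof -
  let ?y = "fst (inv\<^bsub>Aut\<^esub> g) x"
  have "\<sigma> (inv\<^bsub>Aut\<^esub> g) x \<otimes>\<^bsub>Sym\<^esub> \<sigma> g ?y = \<one>\<^bsub>Sym\<^esub>"
    using local_action_mult[of "inv\<^bsub>Aut\<^esub> g" g ?y] local_action_one[of ?y] assms by simp
  then show ?thesis
    using Sym.inv_equality local_action_Bij assms by (simp add: carrier_BijGroup)
qed

text \<open>Distinct colors lead to distinct neighbours, so fixing the neighbours fixes the colors.
  Hence fixing a ball of radius \<open>n\<close> makes the local action trivial at all vertices at
  distance less than \<open>n\<close>.\<close>

lemma local_action_fixed:
  assumes "g \<in> carrier Aut" "x \<in> verts T" "fst g x = x" "\<And>c. c \<in> \<Omega> \<Longrightarrow> fst g (nbr x c) = nbr x c"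
  shows "\<sigma> g x = \<one>\<^bsub>Sym\<^esub>"
proof -
  have "\<sigma> g x c = c" if "c \<in> \<Omega>" for c
    using nbr_inj[of x "\<sigma> g x c" c] fst_nbr[of g x c] assms that by simp
  then show ?thesis by (auto simp: BijGroup_def local_action_def fun_eq_iff)
qed

text \<open>
  The vertex with address \<open>w\<close> seen from \<open>b\<close> is sent to the end of the walk from \<open>b'\<close> along the word
  obtained by applying the prescribed permutations letter by letter; this word is again reduced, which
  makes the map injective.
\<close>

lemma ex_automorphism:
  assumes b: "b \<in> verts T" "b' \<in> verts T"
    and s: "\<And>x. x \<in> verts T \<Longrightarrow> s x \<in> Bij \<Omega>"
    and compat: "\<And>x c. x \<in> verts T \<Longrightarrow> c \<in> \<Omega> \<Longrightarrow> s (nbr x c) c = s x c"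
  obtains u where "u \<in> carrier Aut" "fst u b = b'" "\<And>x. x \<in> verts T \<Longrightarrow> \<sigma> u x = s x"
proof -
  define push where "push = rec_list [] (\<lambda>c w r. s (walk b w) c # r)"
  have push [simp]: "push [] = []" "push (c # w) = s (walk b w) c # push w" for c w
    by (simp_all add: push_def)
  define U where "U x = walk b' (push (address b x))" for x
  note addr = address_reduced[OF b(1)] walk_address[OF b(1)]
  have push_set: "set (push w) \<subseteq> \<Omega>" if "set w \<subseteq> \<Omega>" for w
    using that b(1) by (induction w) (auto intro: Bij_mem[OF s])
  have push_reduced: "push w \<in> reduced_words" if "w \<in> reduced_words" for w
    using that
  proof (induction w rule: induct_list012)
    case 1
    then show ?case by simp
  next
    case (3 c c' w)
    have w: "walk b w \<in> verts T" "c \<in> \<Omega>" "c' \<in> \<Omega>" "c \<noteq> c'" "c' # w \<in> reduced_words"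
      using 3(3) b(1) by (auto simp: reduced_words_def)
    \<comment> \<open>By \<open>compat\<close> the right-hand side is also the value at
      \<open>c'\<close> of the permutation at the middle vertex, and that permutation is
      injective.\<close>
    then have "s (nbr (walk b w) c') c \<noteq> s (walk b w) c'"
      using compat[of "walk b w" c'] Bij_inj[OF s, of "nbr (walk b w) c'" c c'] by auto
    moreover have "push (c' # w) \<in> reduced_words" using 3(2) w(5) by blast
    moreover have "s (nbr (walk b w) c') c \<in> \<Omega>" using Bij_mem[OF s] w by simp
    ultimately show ?case by (auto simp: reduced_words_def)
  next
    case (2 c)
    then show ?case using Bij_mem[OF s[OF b(1)]] by (simp add: reduced_words_def)
  qed
  have push_inj: "v = w" if "push v = push w" "set v \<subseteq> \<Omega>" "set w \<subseteq> \<Omega>" for v w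
    using that
  proof (induction v arbitrary: w)
    case Nil
    then show ?case by (cases w) auto
  next
    case (Cons c v)
    then obtain c' w' where w: "w = c' # w'" by (cases w) auto
    then have "v = w'" using Cons by auto
    moreover from this have "c = c'"
      using Cons.prems w b(1) Bij_inj[OF s, of "walk b v" c c'] by auto
    ultimately show ?case using w by simp
  qed
  have U_in: "U x \<in> verts T" if "x \<in> verts T" for x
    using addr(1)[OF that] push_set b(2) by (simp add: U_def reduced_words_def)
  have U_nbr: "U (nbr x c) = nbr (U x) (s x c)" if xc: "x \<in> verts T" "c \<in> \<Omega>" for x c
  \<comment> \<open>For an outward arc this is the recursion of \<open>push\<close>. For an arc
    towards \<open>b\<close> the recursion is read from the other end, where \<open>compat\<close>
    identifies the color, and is inverted by \<open>nbr_nbr\<close>.\<close>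
  proof (cases rule: nbr_address_cases[OF b(1) xc])
    case 1
    let ?y = "nbr x c"
    have y: "?y \<in> verts T" using xc by simp
    then have "U x = nbr (U ?y) (s ?y c)" using 1 addr(2)[OF y] by (simp add: U_def)
    then have "U x = nbr (U ?y) (s x c)" using compat xc by simp
    then show ?thesis using U_in[OF y] Bij_mem[OF s[OF xc(1)] xc(2)] by simp
  next
    case 2
    then show ?thesis using addr(2)[OF xc(1)] by (simp add: U_def)
  qed
  have U_inj: "x = y" if "x \<in> verts T" "y \<in> verts T" "U x = U y" for x y
  proof -
    have "push (address b x) = push (address b y)"
      using reduced_walk_inj[OF b(2) push_reduced push_reduced] addr(1) that by (simp add: U_def)
    then have "address b x = address b y"
      using push_inj addr(1) that by (simp add: reduced_words_def)
    then have "walk b (address b x) = walk b (address b y)" by (rule arg_cong)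
    then show "x = y" unfolding addr(2)[OF that(1)] addr(2)[OF that(2)] .
  qed
  have "\<exists>x\<in>verts T. U x = walk b' w" if "set w \<subseteq> \<Omega>" for w
    using that
  proof (induction w)
    case Nil
    then show ?case using b by (auto simp: U_def intro!: bexI[of _ b])
  next
    case (Cons c w)
    then obtain x where x: "x \<in> verts T" "U x = walk b' w" by auto
    obtain c0 where "c0 \<in> \<Omega>" "s x c0 = c" using Bij_surj[OF s[OF x(1)], of c] Cons.prems by auto
    then show ?case using U_nbr[of x c0] x by (auto intro!: bexI[of _ "nbr x c0"])
  qed
  then have "\<exists>x\<in>verts T. U x = walk b' (address b' y)" if "y \<in> verts T" for y
    using address_reduced[OF b(2) that] by (simp add: reduced_words_def)
  then have U_surj: "\<exists>x\<in>verts T. U x = y" if "y \<in> verts T" for y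
    using walk_address[OF b(2)] that by metis
  define E where "E e = edge (U (tail T e)) (s (tail T e) (l e))" for e
  have E: "E e \<in> arcs T" "tail T (E e) = U (tail T e)" "l (E e) = s (tail T e) (l e)"
    "head T (E e) = nbr (U (tail T e)) (s (tail T e) (l e))" if "e \<in> arcs T" for e
    using that U_in Bij_mem[OF s] by (auto simp: E_def color_in nbr_def)
  have nbr_head: "head T e = nbr (tail T e) (l e)" if "e \<in> arcs T" for e
    using edge_eq[OF that] by (simp add: nbr_def)
  define u where "u = (restrict U (verts T), restrict E (arcs T))"
  have "bij_betw U (verts T) (verts T)"
  proof (rule bij_betwI')
    fix y assume "y \<in> verts T"
    then show "\<exists>x\<in>verts T. y = U x" using U_surj by metis
  next
    fix x y assume "x \<in> verts T" "y \<in> verts T"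
    then show "U x = U y \<longleftrightarrow> x = y" using U_inj by blast
  qed (rule U_in)
  moreover have "bij_betw E (arcs T) (arcs T)"
  proof (rule bij_betw_imageI)
    show "inj_on E (arcs T)"
    proof (rule inj_onI)
      fix e f assume ef: "e \<in> arcs T" "f \<in> arcs T" "E e = E f"
      then have "U (tail T e) = U (tail T f)" using E(2) by metis
      then have t: "tail T e = tail T f" using U_inj ef tail_in_verts by blast
      then have "s (tail T e) (l e) = s (tail T e) (l f)" using ef E(3) by metis
      then have "l e = l f" using Bij_inj[OF s, of "tail T e"] ef by (simp add: color_in)
      then show "e = f" using t edge_eq ef by metis
    qed
    show "E ` arcs T = arcs T"
    proof (intro equalityI subsetI)
      fix e assume e: "e \<in> arcs T"
      obtain x where x: "x \<in> verts T" "U x = tail T e" using U_surj[of "tail T e"] e by auto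
      obtain c where c: "c \<in> \<Omega>" "s x c = l e" using Bij_surj[OF s[OF x(1)]] color_in[OF e] by auto
      have "E (edge x c) = e" using x c e by (simp add: E_def)
      then show "e \<in> E ` arcs T" using x c by (metis edge_simps(1) imageI)
    qed (use E in auto)
  qed
  moreover have "E (arev e) = arev (E e)" if e: "e \<in> arcs T" for e
  proof -
    let ?x = "tail T e" and ?c = "l e"
    have xc: "?x \<in> verts T" "?c \<in> \<Omega>" using e by (auto simp: color_in)
    have "E (arev e) = edge (U (nbr ?x ?c)) (s (nbr ?x ?c) ?c)"
      using e by (simp add: E_def color_arev nbr_head)
    also have "\<dots> = edge (nbr (U ?x) (s ?x ?c)) (s ?x ?c)"
      using U_nbr compat xc by simp
    also have "\<dots> = arev (E e)"
      using arev_edge U_in Bij_mem[OF s] xc by (simp add: E_def)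
    finally show ?thesis .
  qed
  moreover have "head T (E e) = U (head T e)" if "e \<in> arcs T" for e
    using E(4)[OF that] U_nbr[of "tail T e" "l e"] nbr_head[OF that] that by (simp add: color_in)
  ultimately have "u \<in> carrier Aut"
    using E by (simp add: carrier_Aut u_def Bij_def)
  moreover have "fst u b = b'" using b by (simp add: u_def U_def)
  moreover have "\<sigma> u x = s x" if x: "x \<in> verts T" for x
  proof
    fix c show "\<sigma> u x c = s x c"
    proof (cases "c \<in> \<Omega>")
      case True
      then have "\<sigma> u x c = l (snd u (edge x c))" by (simp add: local_action_def edge_def)
      also have "\<dots> = l (E (edge x c))" using x True by (simp add: u_def)
      also have "\<dots> = s x c" using x True E(3)[of "edge x c"] by simp
      finally show ?thesis .
    next
      case False
      then show ?thesis
        using extensional_arb[OF Bij_imp_extensional[OF s[OF x]]] by (simp add: local_action_def)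
    qed
  qed
  ultimately show ?thesis by (rule that)
qed

section \<open>Elements commensurating a vertex stabilizer\<close>

text \<open>With arbitrary instead of reduced words, only the length has to be followed under
  automorphisms. By \<open>mem_ball_iff\<close> this is still the metric ball.\<close>

definition ball :: "'v \<Rightarrow> nat \<Rightarrow> 'v set" where
  "ball b n = walk b ` {w. set w \<subseteq> \<Omega> \<and> length w \<le> n}"

definition vertex_stabilizer :: "('c \<Rightarrow> 'c) set \<Rightarrow> 'v \<Rightarrow> (('v \<Rightarrow> 'v) \<times> ('e \<Rightarrow> 'e)) set" where
  "vertex_stabilizer H b = {u \<in> universal_group T arev \<Omega> l H. fst u b = b}"

definition ball_fixator :: "('c \<Rightarrow> 'c) set \<Rightarrow> 'v \<Rightarrow> nat \<Rightarrow> (('v \<Rightarrow> 'v) \<times> ('e \<Rightarrow> 'e)) set" where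
  "ball_fixator H b n = {u \<in> vertex_stabilizer H b. \<forall>x\<in>ball b n. fst u x = x}"

lemma finite_ball: "finite (ball b n)"
  unfolding ball_def using finite_lists_length_le[OF finite_colors] by (rule finite_imageI)

lemma ball_mono: "m \<le> n \<Longrightarrow> ball b m \<subseteq> ball b n"
  by (auto simp: ball_def)

lemma ball_subset_verts: "b \<in> verts T \<Longrightarrow> ball b n \<subseteq> verts T"
  by (auto simp: ball_def)

lemma mem_ball_iff:
  assumes "b \<in> verts T" "x \<in> verts T"
  shows "x \<in> ball b n \<longleftrightarrow> length (address b x) \<le> n"
proof
  assume "x \<in> ball b n"
  then obtain w where w: "set w \<subseteq> \<Omega>" "length w \<le> n" "x = walk b w" by (auto simp: ball_def)
  then show "length (address b x) \<le> n" using length_address_walk_le[OF assms(1) w(1)] by simp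
next
  assume "length (address b x) \<le> n"
  then show "x \<in> ball b n"
    using walk_address[OF assms] address_reduced[OF assms] unfolding ball_def reduced_words_def
    by (intro image_eqI[of _ _ "address b x"]) auto
qed

lemma finite_subset_ball:
  assumes "b \<in> verts T" "finite X" "X \<subseteq> verts T"
  shows "\<exists>n. X \<subseteq> ball b n"
proof
  show "X \<subseteq> ball b (Max ((\<lambda>x. length (address b x)) ` X))"
  proof
    fix x assume "x \<in> X"
    then show "x \<in> ball b (Max ((\<lambda>x. length (address b x)) ` X))"
      using mem_ball_iff[OF assms(1)] assms(2,3) by (auto simp: subset_iff)
  qed
qed

lemma fst_walk:
  assumes "g \<in> carrier Aut" "x \<in> verts T" "set w \<subseteq> \<Omega>"
  shows "\<exists>w'. set w' \<subseteq> \<Omega> \<and> length w' = length w \<and> fst g (walk x w) = walk (fst g x) w'"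
  using assms(3)
proof (induction w)
  case (Cons c w)
  then obtain w' where "set w' \<subseteq> \<Omega>" "length w' = length w" "fst g (walk x w) = walk (fst g x) w'"
    by auto
  then show ?case
    using Cons.prems assms(1,2) by (intro exI[of _ "\<sigma> g (walk x w) c # w'"]) (simp add: fst_nbr)
qed (intro exI[of _ "[]"], simp)

lemma fst_ball:
  assumes "g \<in> carrier Aut" "b \<in> verts T" "fst g b = b" "x \<in> ball b n"
  shows "fst g x \<in> ball b n"
proof -
  obtain w where w: "set w \<subseteq> \<Omega>" "length w \<le> n" "x = walk b w" using assms(4) by (auto simp: ball_def)
  obtain w' where "set w' \<subseteq> \<Omega>" "length w' = length w" "fst g x = walk b w'"
    using fst_walk[OF assms(1,2) w(1)] w(3) assms(3) by auto
  then show ?thesis using w(2) by (auto simp: ball_def)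
qed

section \<open>The groups U(H) and G(H) and their vertex stabilizers\<close>

lemma universal_groupD:
  "u \<in> universal_group T arev \<Omega> l H \<Longrightarrow> u \<in> carrier Aut"
  "u \<in> universal_group T arev \<Omega> l H \<Longrightarrow> x \<in> verts T \<Longrightarrow> \<sigma> u x \<in> H"
  by (auto simp: universal_group_def)

lemma subgroup_universal_group:
  assumes "subgroup H Sym"
  shows "subgroup (universal_group T arev \<Omega> l H) Aut"
proof (rule Aut.subgroupI)
  interpret H: subgroup H Sym by fact
  show "universal_group T arev \<Omega> l H \<subseteq> carrier Aut" by (auto simp: universal_group_def)
  have "\<one>\<^bsub>Aut\<^esub> \<in> universal_group T arev \<Omega> l H"
    using H.one_closed by (simp add: universal_group_def local_action_one)
  then show "universal_group T arev \<Omega> l H \<noteq> {}" by blast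
  show "inv\<^bsub>Aut\<^esub> g \<in> universal_group T arev \<Omega> l H" if "g \<in> universal_group T arev \<Omega> l H" for g
    using that H.m_inv_closed by (simp add: universal_group_def local_action_inv)
  show "g \<otimes>\<^bsub>Aut\<^esub> h \<in> universal_group T arev \<Omega> l H"
    if "g \<in> universal_group T arev \<Omega> l H" "h \<in> universal_group T arev \<Omega> l H" for g h
    using that H.m_closed by (simp add: universal_group_def local_action_mult)
qed

lemma inv_almost_universal:
  assumes "subgroup H Sym" and g: "g \<in> almost_universal_group T arev \<Omega> l H"
  shows "inv\<^bsub>Aut\<^esub> g \<in> almost_universal_group T arev \<Omega> l H"
proof -
  interpret H: subgroup H Sym by fact
  have gc: "g \<in> carrier Aut" using g by (simp add: almost_universal_group_def)
  have "{x \<in> verts T. \<sigma> (inv\<^bsub>Aut\<^esub> g) x \<notin> H} \<subseteq> fst g ` {x \<in> verts T. \<sigma> g x \<notin> H}"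
  proof
    fix x assume "x \<in> {x \<in> verts T. \<sigma> (inv\<^bsub>Aut\<^esub> g) x \<notin> H}"
    then have x: "x \<in> verts T" "inv\<^bsub>Sym\<^esub> (\<sigma> g (fst (inv\<^bsub>Aut\<^esub> g) x)) \<notin> H"
      using gc by (auto simp: local_action_inv)
    then have "fst (inv\<^bsub>Aut\<^esub> g) x \<in> {x \<in> verts T. \<sigma> g x \<notin> H}"
      using gc H.m_inv_closed by auto
    then show "x \<in> fst g ` {x \<in> verts T. \<sigma> g x \<notin> H}"
      by (rule image_eqI[where f = "fst g", OF fst_inv(2)[OF gc x(1), symmetric]])
  qed
  moreover have "finite {x \<in> verts T. \<sigma> g x \<notin> H}" using g by (simp add: almost_universal_group_def)
  ultimately have "finite {x \<in> verts T. \<sigma> (inv\<^bsub>Aut\<^esub> g) x \<notin> H}"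
    by (meson finite_imageI finite_subset)
  then show ?thesis using gc by (simp add: almost_universal_group_def)
qed

lemma subgroup_almost_universal_group:
  assumes "subgroup H Sym"
  shows "subgroup (almost_universal_group T arev \<Omega> l H) Aut"
proof (rule Aut.subgroupI)
  interpret H: subgroup H Sym by fact
  show "almost_universal_group T arev \<Omega> l H \<subseteq> carrier Aut" by (auto simp: almost_universal_group_def)
  have empty: "{x \<in> verts T. \<sigma> \<one>\<^bsub>Aut\<^esub> x \<notin> H} = {}" using H.one_closed by (auto simp: local_action_one)
  have "\<one>\<^bsub>Aut\<^esub> \<in> almost_universal_group T arev \<Omega> l H"
    unfolding almost_universal_group_def mem_Collect_eq empty by simp
  then show "almost_universal_group T arev \<Omega> l H \<noteq> {}" by blast
  show "inv\<^bsub>Aut\<^esub> g \<in> almost_universal_group T arev \<Omega> l H"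
    if "g \<in> almost_universal_group T arev \<Omega> l H" for g
    using inv_almost_universal[OF assms that] .
  fix g h assume g: "g \<in> almost_universal_group T arev \<Omega> l H"
    and h: "h \<in> almost_universal_group T arev \<Omega> l H"
  have gc: "g \<in> carrier Aut" "h \<in> carrier Aut" using g h by (auto simp: almost_universal_group_def)
  \<comment> \<open>An exceptional vertex of the product is exceptional for \<open>h\<close> or is
    carried by \<open>h\<close> to one that is exceptional for \<open>g\<close>.\<close>
  have "{x \<in> verts T. \<sigma> (g \<otimes>\<^bsub>Aut\<^esub> h) x \<notin> H} \<subseteq>
      {x \<in> verts T. \<sigma> h x \<notin> H} \<union> fst (inv\<^bsub>Aut\<^esub> h) ` {x \<in> verts T. \<sigma> g x \<notin> H}"
  proof
    fix x assume "x \<in> {x \<in> verts T. \<sigma> (g \<otimes>\<^bsub>Aut\<^esub> h) x \<notin> H}"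
    then have x: "x \<in> verts T" "\<sigma> g (fst h x) \<otimes>\<^bsub>Sym\<^esub> \<sigma> h x \<notin> H"
      using gc by (auto simp: local_action_mult)
    then have "\<sigma> h x \<notin> H \<or> fst h x \<in> {x \<in> verts T. \<sigma> g x \<notin> H}"
      using gc H.m_closed by auto
    then show "x \<in> {x \<in> verts T. \<sigma> h x \<notin> H} \<union> fst (inv\<^bsub>Aut\<^esub> h) ` {x \<in> verts T. \<sigma> g x \<notin> H}"
      using fst_inv(1)[OF gc(2) x(1)] x(1) by (metis (mono_tags, lifting) UnCI imageI mem_Collect_eq)
  qed
  moreover have "finite {x \<in> verts T. \<sigma> g x \<notin> H}" "finite {x \<in> verts T. \<sigma> h x \<notin> H}"
    using g h by (simp_all add: almost_universal_group_def)
  ultimately have "finite {x \<in> verts T. \<sigma> (g \<otimes>\<^bsub>Aut\<^esub> h) x \<notin> H}"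
    by (meson finite_Un finite_imageI finite_subset)
  then show "g \<otimes>\<^bsub>Aut\<^esub> h \<in> almost_universal_group T arev \<Omega> l H"
    using gc by (simp add: almost_universal_group_def)
qed

lemma subgroup_restricted_universal_group:
  assumes "subgroup H Sym" "subgroup K Sym"
  shows "subgroup (restricted_universal_group T arev \<Omega> l H K) Aut"
  unfolding restricted_universal_group_def
  by (intro Aut.subgroups_Inter_pair subgroup_almost_universal_group subgroup_universal_group assms)

lemma universal_subset_restricted:
  assumes "H \<subseteq> F" "F \<subseteq> F'"
  shows "universal_group T arev \<Omega> l H \<subseteq> restricted_universal_group T arev \<Omega> l F F'"
proof
  fix g assume g: "g \<in> universal_group T arev \<Omega> l H"
  then have empty: "{x \<in> verts T. \<sigma> g x \<notin> F} = {}"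
    using assms(1) universal_groupD(2)[OF g] by blast
  show "g \<in> restricted_universal_group T arev \<Omega> l F F'"
    using g assms unfolding restricted_universal_group_def almost_universal_group_def Int_iff mem_Collect_eq empty
    by (auto simp: universal_group_def)
qed

lemma subgroup_stabilizer:
  assumes "subgroup M Aut" "b \<in> verts T"
  shows "subgroup {u \<in> M. fst u b = b} Aut"
proof (rule Aut.subgroupI)
  interpret M: subgroup M Aut by fact
  show "{u \<in> M. fst u b = b} \<subseteq> carrier Aut" using M.subset by blast
  have "\<one>\<^bsub>Aut\<^esub> \<in> {u \<in> M. fst u b = b}" using assms(2) by (simp add: Aut_one)
  then show "{u \<in> M. fst u b = b} \<noteq> {}" by blast
  show "inv\<^bsub>Aut\<^esub> g \<in> {u \<in> M. fst u b = b}" if g: "g \<in> {u \<in> M. fst u b = b}" for g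
    using g fst_inv(1)[of g b] assms(2) M.mem_carrier by auto
  show "g \<otimes>\<^bsub>Aut\<^esub> h \<in> {u \<in> M. fst u b = b}"
    if "g \<in> {u \<in> M. fst u b = b}" "h \<in> {u \<in> M. fst u b = b}" for g h
    using that assms(2) M.mem_carrier by (simp add: Aut_mult)
qed

lemma subgroup_vertex_stabilizer:
  "subgroup H Sym \<Longrightarrow> b \<in> verts T \<Longrightarrow> subgroup (vertex_stabilizer H b) Aut"
  unfolding vertex_stabilizer_def by (intro subgroup_stabilizer subgroup_universal_group)

section \<open>Ball fixators and a criterion for commensuration\<close>

lemma vertex_stabilizer_carrier: "vertex_stabilizer H b \<subseteq> carrier Aut"
  by (auto simp: vertex_stabilizer_def universal_group_def)

lemma ball_fixator_carrier: "ball_fixator H b n \<subseteq> carrier Aut"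
  using vertex_stabilizer_carrier by (auto simp: ball_fixator_def)

lemma ball_fixator_antimono: "m \<le> n \<Longrightarrow> ball_fixator H b n \<subseteq> ball_fixator H b m"
  using ball_mono[of m n b] unfolding ball_fixator_def by blast

lemma finitely_covered_ball_fixator:
  assumes "subgroup H Sym" "b \<in> verts T"
  shows "Aut.finitely_covered (vertex_stabilizer H b) (ball_fixator H b n)"
proof (rule Aut.finitely_coveredI)
  interpret S: subgroup "vertex_stabilizer H b" Aut
    using subgroup_vertex_stabilizer[OF assms] .
  \<comment> \<open>Inverses are recorded because the coverings use right cosets:
    \<open>s \<otimes> inv t\<close> fixes \<open>x\<close> exactly when \<open>inv s\<close> and
    \<open>inv t\<close> agree at \<open>x\<close>. The stabilizer preserves the finite ball, so
    only finitely many maps occur.\<close>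
  let ?f = "\<lambda>s. restrict (fst (inv\<^bsub>Aut\<^esub> s)) (ball b n)"
  have "?f s \<in> ball b n \<rightarrow>\<^sub>E ball b n" if s: "s \<in> vertex_stabilizer H b" for s
  proof -
    have inv: "inv\<^bsub>Aut\<^esub> s \<in> carrier Aut" "fst (inv\<^bsub>Aut\<^esub> s) b = b"
      using S.m_inv_closed[OF s] unfolding vertex_stabilizer_def universal_group_def by blast+
    show ?thesis unfolding restrict_PiE_iff using fst_ball[OF inv(1) assms(2) inv(2)] by blast
  qed
  then have "?f ` vertex_stabilizer H b \<subseteq> ball b n \<rightarrow>\<^sub>E ball b n"
    by (rule image_subsetI)
  then show "finite (?f ` vertex_stabilizer H b)"
    by (rule finite_subset) (intro finite_PiE finite_ball)
  show "s \<otimes>\<^bsub>Aut\<^esub> inv\<^bsub>Aut\<^esub> t \<in> ball_fixator H b n"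
    if s: "s \<in> vertex_stabilizer H b" and t: "t \<in> vertex_stabilizer H b" and eq: "?f s = ?f t" for s t
  proof -
    have "fst (s \<otimes>\<^bsub>Aut\<^esub> inv\<^bsub>Aut\<^esub> t) x = x" if x: "x \<in> ball b n" for x
    proof -
      have xv: "x \<in> verts T" using x ball_subset_verts assms(2) by blast
      have "fst (inv\<^bsub>Aut\<^esub> s) x = fst (inv\<^bsub>Aut\<^esub> t) x"
        using fun_cong[OF eq, of x] unfolding restrict_apply' [OF x] .
      then have "fst s (fst (inv\<^bsub>Aut\<^esub> t) x) = x"
        using fst_inv(2)[OF S.mem_carrier[OF s] xv] by (simp only:)
      then show ?thesis
        unfolding Aut_mult(1)[OF S.mem_carrier[OF s] S.mem_carrier[OF S.m_inv_closed[OF t]] xv] .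
    qed
    moreover have "s \<otimes>\<^bsub>Aut\<^esub> inv\<^bsub>Aut\<^esub> t \<in> vertex_stabilizer H b" 
      by (rule S.m_closed[OF s S.m_inv_closed[OF t]])
    ultimately show ?thesis unfolding ball_fixator_def by blast
  qed
qed (rule vertex_stabilizer_carrier ball_fixator_carrier)+

lemma commensurator_ballI:
  assumes "subgroup H Sym" "b \<in> verts T"
    and M: "subgroup M Aut" "vertex_stabilizer H b \<subseteq> M" "g \<in> M"
    and "\<And>u. u \<in> ball_fixator H b m \<Longrightarrow> g \<otimes>\<^bsub>Aut\<^esub> u \<otimes>\<^bsub>Aut\<^esub> inv\<^bsub>Aut\<^esub> g \<in> vertex_stabilizer H b"
    and "\<And>u. u \<in> ball_fixator H b n \<Longrightarrow> inv\<^bsub>Aut\<^esub> g \<otimes>\<^bsub>Aut\<^esub> u \<otimes>\<^bsub>Aut\<^esub> g \<in> vertex_stabilizer H b"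
  shows "g \<in> commensurator (Aut\<lparr>carrier := M\<rparr>) (vertex_stabilizer H b)"
proof (rule Aut.commensuratorI)
  have gc: "g \<in> carrier Aut" using M(1,3) subgroup.subset by blast
  show "Aut.conj_set g (ball_fixator H b m) \<subseteq> vertex_stabilizer H b"
    using assms(6) by (auto simp: Aut.mem_conj_set)
  show "Aut.conj_set (inv\<^bsub>Aut\<^esub> g) (ball_fixator H b n) \<subseteq> vertex_stabilizer H b"
    using assms(7) gc by (auto simp: Aut.mem_conj_set)
  show "Aut.finitely_covered (vertex_stabilizer H b) (ball_fixator H b m)"
    "Aut.finitely_covered (vertex_stabilizer H b) (ball_fixator H b n)"
    using assms by (simp_all add: finitely_covered_ball_fixator)
qed (rule M subgroup_vertex_stabilizer[OF assms(1,2)] ball_fixator_carrier)+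

text \<open>Evaluating at \<open>fst g x\<close> instead of \<open>x\<close> keeps the inverse of
  \<open>g\<close> out of the vertex arguments.\<close>

lemma local_action_conj:
  assumes "g \<in> carrier Aut" "u \<in> carrier Aut" "x \<in> verts T"
  shows "\<sigma> (g \<otimes>\<^bsub>Aut\<^esub> u \<otimes>\<^bsub>Aut\<^esub> inv\<^bsub>Aut\<^esub> g) (fst g x) =
    \<sigma> g (fst u x) \<otimes>\<^bsub>Sym\<^esub> \<sigma> u x \<otimes>\<^bsub>Sym\<^esub> inv\<^bsub>Sym\<^esub> (\<sigma> g x)"
  using assms by (simp add: local_action_mult local_action_inv)

lemma conj_in_vertex_stabilizerI:
  assumes "g \<in> carrier Aut" "u \<in> carrier Aut" "b \<in> verts T"
    and "fst u (fst (inv\<^bsub>Aut\<^esub> g) b) = fst (inv\<^bsub>Aut\<^esub> g) b"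
    and act: "\<And>x. x \<in> verts T \<Longrightarrow>
      \<sigma> g (fst u x) \<otimes>\<^bsub>Sym\<^esub> \<sigma> u x \<otimes>\<^bsub>Sym\<^esub> inv\<^bsub>Sym\<^esub> (\<sigma> g x) \<in> H"
  shows "g \<otimes>\<^bsub>Aut\<^esub> u \<otimes>\<^bsub>Aut\<^esub> inv\<^bsub>Aut\<^esub> g \<in> vertex_stabilizer H b"
proof -
  let ?w = "g \<otimes>\<^bsub>Aut\<^esub> u \<otimes>\<^bsub>Aut\<^esub> inv\<^bsub>Aut\<^esub> g"
  have "\<sigma> ?w y \<in> H" if y: "y \<in> verts T" for y
    using local_action_conj[OF assms(1,2), of "fst (inv\<^bsub>Aut\<^esub> g) y"]
      act[of "fst (inv\<^bsub>Aut\<^esub> g) y"] assms(1) y by simp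
  moreover have "fst ?w b = b" using assms(1-4) by (simp add: Aut_mult)
  ultimately show ?thesis
    using assms(1,2) by (simp add: vertex_stabilizer_def universal_group_def)
qed

section \<open>Commensuration by almost universal elements\<close>

lemma almost_universal_conj:
  assumes "subgroup H Sym" "b \<in> verts T" and g: "g \<in> almost_universal_group T arev \<Omega> l H"
  shows "\<exists>n. \<forall>u\<in>ball_fixator H b n. g \<otimes>\<^bsub>Aut\<^esub> u \<otimes>\<^bsub>Aut\<^esub> inv\<^bsub>Aut\<^esub> g \<in> vertex_stabilizer H b"
proof -
  interpret H: subgroup H Sym by fact
  define X where "X = {x \<in> verts T. \<sigma> g x \<notin> H}"
  have gc: "g \<in> carrier Aut" and "finite X"
    using g by (auto simp: almost_universal_group_def X_def)
  \<comment> \<open>The neighbours make \<sigma>(u, x) trivial at the exceptional vertices; the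
    preimage of \<open>b\<close> under \<open>g\<close> makes the conjugate fix
    \<open>b\<close>.\<close>
  let ?Y = "X \<union> (\<Union>x\<in>X. nbr x ` \<Omega>) \<union> {fst (inv\<^bsub>Aut\<^esub> g) b}"
  have "finite ?Y" using \<open>finite X\<close> finite_colors by simp
  moreover have "?Y \<subseteq> verts T" using gc assms(2) by (auto simp: X_def)
  ultimately have "\<exists>n. ?Y \<subseteq> ball b n" by (rule finite_subset_ball[OF assms(2)])
  then obtain n where n: "?Y \<subseteq> ball b n" by (rule exE)
  have "g \<otimes>\<^bsub>Aut\<^esub> u \<otimes>\<^bsub>Aut\<^esub> inv\<^bsub>Aut\<^esub> g \<in> vertex_stabilizer H b" if u: "u \<in> ball_fixator H b n" for u
  proof (rule conj_in_vertex_stabilizerI[OF gc _ assms(2)])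
    have uU: "u \<in> universal_group T arev \<Omega> l H"
      using u unfolding ball_fixator_def vertex_stabilizer_def by blast
    note uc = universal_groupD(1)[OF uU] and uH = universal_groupD(2)[OF uU]
    have fix_ball: "fst u x = x" if "x \<in> ?Y" for x
      using u n that unfolding ball_fixator_def by blast
    show "u \<in> carrier Aut" by fact
    show "fst u (fst (inv\<^bsub>Aut\<^esub> g) b) = fst (inv\<^bsub>Aut\<^esub> g) b" using fix_ball by blast
    fix x assume x: "x \<in> verts T"
    have gx: "\<sigma> g x \<in> carrier Sym" using local_action_Bij[OF gc x] by (simp add: carrier_BijGroup)
    show "\<sigma> g (fst u x) \<otimes>\<^bsub>Sym\<^esub> \<sigma> u x \<otimes>\<^bsub>Sym\<^esub> inv\<^bsub>Sym\<^esub> (\<sigma> g x) \<in> H"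
    proof (cases "x \<in> X")
      case True
      then have ux: "fst u x = x" using fix_ball by blast
      have "\<sigma> u x = \<one>\<^bsub>Sym\<^esub>"
      proof (rule local_action_fixed[OF uc x ux])
        fix c assume "c \<in> \<Omega>"
        then show "fst u (nbr x c) = nbr x c" using fix_ball True by blast
      qed
      then show ?thesis using gx by (simp add: ux)
    next
      case False
      \<comment> \<open>\<open>u\<close> fixes \<open>X\<close> pointwise, so by injectivity it
        moves no other vertex into \<open>X\<close>; all three factors then lie in
        \<open>H\<close>.\<close>
      have "fst u x \<notin> X"
      proof
        assume "fst u x \<in> X"
        then have ux: "fst u (fst u x) = fst u x" using fix_ball by blast
        have "fst u x = fst (inv\<^bsub>Aut\<^esub> u) (fst u (fst u x))"
          by (rule fst_inv(1)[OF uc fst_in_verts[OF uc x], symmetric])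
        also have "\<dots> = fst (inv\<^bsub>Aut\<^esub> u) (fst u x)" by (simp only: ux)
        also have "\<dots> = x" by (rule fst_inv(1)[OF uc x])
        finally have "fst u x = x" .
        then show False using False \<open>fst u x \<in> X\<close> by simp
      qed
      then show ?thesis using False x uc uH[OF x] by (simp add: X_def)
    qed
  qed
  then show ?thesis by blast
qed

lemma almost_universal_commensurates:
  assumes H: "subgroup H Sym" and b: "b \<in> verts T" and M: "subgroup M Aut" "vertex_stabilizer H b \<subseteq> M" "g \<in> M"
    and g: "g \<in> almost_universal_group T arev \<Omega> l H"
  shows "g \<in> commensurator (Aut\<lparr>carrier := M\<rparr>) (vertex_stabilizer H b)"
proof -
  have gc: "g \<in> carrier Aut" using M(1,3) subgroup.subset by blast
  obtain m where "\<forall>u\<in>ball_fixator H b m. g \<otimes>\<^bsub>Aut\<^esub> u \<otimes>\<^bsub>Aut\<^esub> inv\<^bsub>Aut\<^esub> g \<in> vertex_stabilizer H b"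
    using almost_universal_conj[OF H b g] by blast
  moreover obtain n where "\<forall>u\<in>ball_fixator H b n. inv\<^bsub>Aut\<^esub> g \<otimes>\<^bsub>Aut\<^esub> u \<otimes>\<^bsub>Aut\<^esub> g \<in> vertex_stabilizer H b"
    using almost_universal_conj[OF H b inv_almost_universal[OF H g]] unfolding Aut.inv_inv[OF gc] by blast
  ultimately show ?thesis using commensurator_ballI[OF H b M] by blast
qed

section \<open>Commensuration by elements with normalizing local actions\<close>

lemma base_in_ball: "b \<in> ball b n"
  unfolding ball_def by (rule image_eqI[of _ _ "[]"]) simp_all

lemma nbr_in_ball:
  assumes "b \<in> verts T" "x \<in> verts T" "c \<in> \<Omega>" "length (address b x) < n"
  shows "nbr x c \<in> ball b n"
proof -
  have "length (address b (nbr x c)) \<le> n"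
    using assms(4) by (cases rule: nbr_address_cases[OF assms(1-3)]) simp_all
  then show ?thesis using mem_ball_iff[OF assms(1) nbr_in_verts[OF assms(2,3)]] by simp
qed

text \<open>
  An automorphism with local action in \<open>H\<close> on a ball is extended constantly along the branches
  leaving the ball.
\<close>

lemma extend_from_ball:
  assumes H: "subgroup H Sym" and b: "b \<in> verts T" and w: "w \<in> carrier Aut" "fst w b = b"
    and act: "\<And>y. y \<in> verts T \<Longrightarrow> length (address b y) < k \<Longrightarrow> \<sigma> w y \<in> H"
  shows "\<exists>u\<in>vertex_stabilizer H b. \<forall>y\<in>ball b k. fst u y = fst w y"
proof (cases k)
  \<comment> \<open>For radius 0 the assumption \<open>act\<close> is empty and the ball is just
    \<open>{b}\<close>, so the identity serves.\<close>
  case 0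
  have "\<one>\<^bsub>Aut\<^esub> \<in> vertex_stabilizer H b"
    using subgroup.one_closed[OF subgroup_vertex_stabilizer[OF H b]] .
  moreover have "fst \<one>\<^bsub>Aut\<^esub> y = fst w y" if "y \<in> ball b k" for y
  proof -
    have "y = b" using that unfolding ball_def 0 by auto
    then show ?thesis using w(2) Aut_one(1)[OF b] by simp
  qed
  ultimately show ?thesis by blast
next
  case (Suc j)
  \<comment> \<open>The projection to the ball of radius \<open>j = k - 1\<close>: the last letter
    of an address is the first step, so \<open>drop\<close> keeps the first \<open>j\<close> steps,
    and truncated subtraction makes \<open>r\<close> the identity inside the ball. Local actions
    within radius \<open>j\<close> already determine the images of all vertices within radius
    \<open>k\<close>.\<close>
  define r where "r y = walk b (drop (length (address b y) - j) (address b y))" for y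
  have drop_set: "set (drop m (address b y)) \<subseteq> \<Omega>" if "y \<in> verts T" for y m
    using address_reduced[OF b that] set_drop_subset[of m "address b y"] by (auto simp: reduced_words_def)
  have r_in: "r y \<in> verts T" if "y \<in> verts T" for y
    unfolding r_def by (rule walk_in_verts[OF b drop_set[OF that]])
  have r_length: "length (address b (r y)) < k" if "y \<in> verts T" for y
    using length_address_walk_le[OF b drop_set[OF that, of "length (address b y) - j"]] Suc
    by (simp add: r_def)
  have r_id: "r y = y" if "y \<in> verts T" "length (address b y) \<le> j" for y
    using that walk_address[OF b that(1)] by (simp add: r_def)
  \<comment> \<open>Inside the ball this is the compatibility of \<open>w\<close> itself; from the
    sphere of radius \<open>j\<close> outwards both ends project to the same vertex.\<close>
  have compat: "\<sigma> w (r (nbr y c)) c = \<sigma> w (r y) c"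
    if y: "y \<in> verts T" "c \<in> \<Omega>" and addr: "address b (nbr y c) = c # address b y" for y c
  proof (cases "length (address b y) < j")
    case True
    then have "r (nbr y c) = nbr y c" "r y = y" using y addr by (simp_all add: r_id)
    then show ?thesis using local_action_nbr[OF w(1) y] by simp
  next
    case False
    then have "Suc (length (address b y)) - j = Suc (length (address b y) - j)" by simp
    then have "r (nbr y c) = r y" unfolding r_def addr by simp
    then show ?thesis by simp
  qed
  obtain u where u: "u \<in> carrier Aut" "fst u b = b" "\<And>y. y \<in> verts T \<Longrightarrow> \<sigma> u y = \<sigma> w (r y)"
  proof (rule ex_automorphism[OF b b, of "\<lambda>y. \<sigma> w (r y)"])
    show "\<sigma> w (r y) \<in> Bij \<Omega>" if "y \<in> verts T" for y
      by (rule local_action_Bij[OF w(1) r_in[OF that]])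
    show "\<sigma> w (r (nbr y c)) c = \<sigma> w (r y) c" if y: "y \<in> verts T" "c \<in> \<Omega>" for y c
    proof (cases rule: nbr_address_cases[OF b y])
      case 1
      then have "address b (nbr (nbr y c) c) = c # address b (nbr y c)" using y by simp
      from compat[OF nbr_in_verts[OF y] y(2) this] show ?thesis unfolding nbr_nbr[OF y] by (rule sym)
    next
      case 2
      then show ?thesis by (rule compat[OF y])
    qed
  qed blast
  have "\<sigma> u y \<in> H" if "y \<in> verts T" for y
    unfolding u(3)[OF that] by (rule act[OF r_in[OF that] r_length[OF that]])
  then have "u \<in> vertex_stabilizer H b"
    using u(1,2) by (simp add: vertex_stabilizer_def universal_group_def)
  moreover have "fst u (walk b v) = fst w (walk b v)" if "set v \<subseteq> \<Omega>" "length v \<le> k" for v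
    using that
  proof (induction v)
    case Nil
    then show ?case using u(2) w(2) by simp
  next
    case (Cons c v)
    let ?z = "walk b v"
    have c: "c \<in> \<Omega>" "set v \<subseteq> \<Omega>" "length v \<le> k" using Cons.prems by auto
    have z: "?z \<in> verts T" using c(2) b by simp
    have "length (address b ?z) \<le> j" using length_address_walk_le[OF b c(2)] Cons.prems(2) Suc by simp
    then have "\<sigma> u ?z = \<sigma> w ?z" using u(3)[OF z] r_id[OF z] by simp
    then show ?case
      using Cons.IH[OF c(2,3)] fst_nbr[OF u(1) z c(1)] fst_nbr[OF w(1) z c(1)] by simp
  qed
  then have "\<forall>y\<in>ball b k. fst u y = fst w y" by (auto simp: ball_def)
  ultimately show ?thesis by blast
qed

text \<open>
  The local actions of \<open>w = inv g \<otimes> v \<otimes> g\<close> are controlled by induction on the distance from \<open>b\<close>: if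
  they lie in \<open>H\<close> closer to \<open>b\<close>, then up to the next sphere \<open>w\<close> agrees with some \<open>u\<close> in the fixator of
  the ball of radius \<open>n\<close>, so that \<open>orb\<close> applies to \<open>w\<close> there.
\<close>

lemma normalizing_inv_conj:
  assumes H: "subgroup H Sym" and b: "b \<in> verts T" and g: "g \<in> carrier Aut"
    and norm: "\<And>x h. x \<in> verts T \<Longrightarrow> h \<in> H \<Longrightarrow>
      inv\<^bsub>Sym\<^esub> (\<sigma> g x) \<otimes>\<^bsub>Sym\<^esub> h \<otimes>\<^bsub>Sym\<^esub> \<sigma> g x \<in> H"
    and orb: "\<And>u x. u \<in> ball_fixator H b n \<Longrightarrow> x \<in> verts T \<Longrightarrow>
      \<sigma> g (fst u x) \<otimes>\<^bsub>Sym\<^esub> inv\<^bsub>Sym\<^esub> (\<sigma> g x) \<in> H"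
  shows "\<exists>m. \<forall>v\<in>ball_fixator H b m. inv\<^bsub>Aut\<^esub> g \<otimes>\<^bsub>Aut\<^esub> v \<otimes>\<^bsub>Aut\<^esub> g \<in> vertex_stabilizer H b"
proof -
  interpret H: subgroup H Sym by fact
  \<comment> \<open>\<open>v\<close> is to fix the image under \<open>g\<close> of the ball of
    radius \<open>n\<close>, so that its conjugate fixes that ball.\<close>
  have "\<exists>m. fst g ` ball b n \<subseteq> ball b m"
    using fst_in_verts[OF g] ball_subset_verts[OF b]
    by (intro finite_subset_ball[OF b] finite_imageI finite_ball image_subsetI) blast
  then obtain m where m: "fst g ` ball b n \<subseteq> ball b m" by (rule exE)
  have "inv\<^bsub>Aut\<^esub> g \<otimes>\<^bsub>Aut\<^esub> v \<otimes>\<^bsub>Aut\<^esub> g \<in> vertex_stabilizer H b" if v: "v \<in> ball_fixator H b m" for v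
  proof -
    have vU: "v \<in> universal_group T arev \<Omega> l H"
      using v unfolding ball_fixator_def vertex_stabilizer_def by blast
    note vc = universal_groupD(1)[OF vU] and vH = universal_groupD(2)[OF vU]
    define w where "w = inv\<^bsub>Aut\<^esub> g \<otimes>\<^bsub>Aut\<^esub> v \<otimes>\<^bsub>Aut\<^esub> g"
    have wc: "w \<in> carrier Aut" using g vc by (simp add: w_def)
    have fst_w: "fst w x = fst (inv\<^bsub>Aut\<^esub> g) (fst v (fst g x))" if "x \<in> verts T" for x
      using that g vc by (simp add: w_def Aut_mult)
    have act_w: "\<sigma> w x = inv\<^bsub>Sym\<^esub> (\<sigma> g (fst w x)) \<otimes>\<^bsub>Sym\<^esub> \<sigma> v (fst g x) \<otimes>\<^bsub>Sym\<^esub> \<sigma> g x"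
      if "x \<in> verts T" for x
      using that g vc by (simp add: fst_w) (simp add: w_def local_action_mult local_action_inv)
    have w_fix: "fst w x = x" if "x \<in> ball b n" for x
    proof -
      have "fst v (fst g x) = fst g x" using v m that unfolding ball_fixator_def by blast
      moreover have "x \<in> verts T" using that ball_subset_verts[OF b] by blast
      ultimately show ?thesis using g by (simp add: fst_w)
    qed
    have "\<sigma> w x \<in> H" if "x \<in> verts T" for x
      using that
    proof (induction "length (address b x)" arbitrary: x rule: less_induct)
      case less
      note x = less.prems
      show ?case
      \<comment> \<open>Below radius \<open>n\<close> all neighbours of \<open>x\<close> still lie
        in the fixed ball. From radius \<open>n\<close> on, the ball reaching up to \<open>x\<close>
        contains the one of radius \<open>n\<close>, so an element agreeing with \<open>w\<close>
        there fixes the latter.\<close>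
      proof (cases "length (address b x) < n")
        case True
        have "\<sigma> w x = \<one>\<^bsub>Sym\<^esub>"
        proof (rule local_action_fixed[OF wc x])
          show "fst w x = x" using w_fix mem_ball_iff[OF b x] True by simp
          show "fst w (nbr x c) = nbr x c" if "c \<in> \<Omega>" for c
            by (rule w_fix[OF nbr_in_ball[OF b x that True]])
        qed
        then show ?thesis by simp
      next
        case False
        let ?k = "length (address b x)"
        have "\<exists>u\<in>vertex_stabilizer H b. \<forall>y\<in>ball b ?k. fst u y = fst w y"
          using less.hyps by (intro extend_from_ball[OF H b wc w_fix[OF base_in_ball]]) blast
        then obtain u where u: "u \<in> vertex_stabilizer H b" "\<forall>y\<in>ball b ?k. fst u y = fst w y"
          by (rule bexE)
        have "ball b n \<subseteq> ball b ?k" using False by (intro ball_mono) simp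
        then have "\<forall>y\<in>ball b n. fst u y = y" using u(2) w_fix by (metis subsetD)
        then have "u \<in> ball_fixator H b n" using u(1) unfolding ball_fixator_def by blast
        then have "\<sigma> g (fst u x) \<otimes>\<^bsub>Sym\<^esub> inv\<^bsub>Sym\<^esub> (\<sigma> g x) \<in> H" using x by (rule orb)
        moreover have "fst u x = fst w x" using u(2) mem_ball_iff[OF b x] by simp
        \<comment> \<open>With this \<open>?h\<close> in \<open>H\<close>, the local action of
          \<open>w\<close> at \<open>x\<close> is the conjugate of inv \<open>?h\<close> \<sigma>(v,
          g x) by inv \<sigma>(g, x), which \<open>norm\<close> keeps in \<open>H\<close>.\<close>
        ultimately have h: "\<sigma> g (fst w x) \<otimes>\<^bsub>Sym\<^esub> inv\<^bsub>Sym\<^esub> (\<sigma> g x) \<in> H" (is "?h \<in> H") by simp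
        have gx: "\<sigma> g x \<in> carrier Sym" "\<sigma> g (fst w x) \<in> carrier Sym"
          using local_action_Bij g x wc by (simp_all add: carrier_BijGroup)
        have k: "\<sigma> v (fst g x) \<in> H" by (rule vH[OF fst_in_verts[OF g x]])
        then have kc: "\<sigma> v (fst g x) \<in> carrier Sym" by (rule H.mem_carrier)
        have "inv\<^bsub>Sym\<^esub> (\<sigma> g x) \<otimes>\<^bsub>Sym\<^esub> (inv\<^bsub>Sym\<^esub> ?h \<otimes>\<^bsub>Sym\<^esub> \<sigma> v (fst g x)) \<otimes>\<^bsub>Sym\<^esub> \<sigma> g x \<in> H"
          by (rule norm[OF x H.m_closed[OF H.m_inv_closed[OF h] k]])
        moreover have "inv\<^bsub>Sym\<^esub> (\<sigma> g x) \<otimes>\<^bsub>Sym\<^esub> inv\<^bsub>Sym\<^esub> ?h = inv\<^bsub>Sym\<^esub> (\<sigma> g (fst w x))"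
          using gx by (simp add: Sym.inv_mult_group Sym.m_assoc[symmetric])
        then have "inv\<^bsub>Sym\<^esub> (\<sigma> g x) \<otimes>\<^bsub>Sym\<^esub> (inv\<^bsub>Sym\<^esub> ?h \<otimes>\<^bsub>Sym\<^esub> \<sigma> v (fst g x)) \<otimes>\<^bsub>Sym\<^esub> \<sigma> g x =
            inv\<^bsub>Sym\<^esub> (\<sigma> g (fst w x)) \<otimes>\<^bsub>Sym\<^esub> \<sigma> v (fst g x) \<otimes>\<^bsub>Sym\<^esub> \<sigma> g x"
          using gx kc H.mem_carrier[OF h] by (simp add: Sym.m_assoc[symmetric])
        ultimately show ?thesis unfolding act_w[OF x] by (simp only:)
      qed
    qed
    moreover have "fst w b = b" by (rule w_fix[OF base_in_ball])
    ultimately show ?thesis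
      unfolding w_def[symmetric] using wc by (simp add: vertex_stabilizer_def universal_group_def)
  qed
  then show ?thesis by blast
qed

lemma normalizing_commensurates:
  assumes H: "subgroup H Sym" and b: "b \<in> verts T"
    and M: "subgroup M Aut" "vertex_stabilizer H b \<subseteq> M" "g \<in> M"
    and norm: "\<And>x h. x \<in> verts T \<Longrightarrow> h \<in> H \<Longrightarrow>
      \<sigma> g x \<otimes>\<^bsub>Sym\<^esub> h \<otimes>\<^bsub>Sym\<^esub> inv\<^bsub>Sym\<^esub> (\<sigma> g x) \<in> H"
    and norm': "\<And>x h. x \<in> verts T \<Longrightarrow> h \<in> H \<Longrightarrow>
      inv\<^bsub>Sym\<^esub> (\<sigma> g x) \<otimes>\<^bsub>Sym\<^esub> h \<otimes>\<^bsub>Sym\<^esub> \<sigma> g x \<in> H"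
    and orb: "\<And>u x. u \<in> ball_fixator H b n \<Longrightarrow> x \<in> verts T \<Longrightarrow>
      \<sigma> g (fst u x) \<otimes>\<^bsub>Sym\<^esub> inv\<^bsub>Sym\<^esub> (\<sigma> g x) \<in> H"
  shows "g \<in> commensurator (Aut\<lparr>carrier := M\<rparr>) (vertex_stabilizer H b)"
proof -
  interpret H: subgroup H Sym by fact
  have g: "g \<in> carrier Aut" using M(1,3) subgroup.subset by blast
  obtain m where m: "\<forall>v\<in>ball_fixator H b m.
      inv\<^bsub>Aut\<^esub> g \<otimes>\<^bsub>Aut\<^esub> v \<otimes>\<^bsub>Aut\<^esub> g \<in> vertex_stabilizer H b"
    using normalizing_inv_conj[OF H b g norm' orb] by (rule exE)
  let ?a = "fst (inv\<^bsub>Aut\<^esub> g) b"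
  have a: "?a \<in> verts T" using g b by simp
  \<comment> \<open>Radius \<open>n\<close> makes \<open>orb\<close> applicable; the second term
    places \<open>?a\<close> in the fixed ball, so that the conjugate fixes
    \<open>b\<close>.\<close>
  define k where "k = max n (length (address b ?a))"
  have "g \<otimes>\<^bsub>Aut\<^esub> u \<otimes>\<^bsub>Aut\<^esub> inv\<^bsub>Aut\<^esub> g \<in> vertex_stabilizer H b" if u: "u \<in> ball_fixator H b k" for u
  proof (rule conj_in_vertex_stabilizerI[OF g _ b])
    have uU: "u \<in> universal_group T arev \<Omega> l H"
      using u unfolding ball_fixator_def vertex_stabilizer_def by blast
    note uc = universal_groupD(1)[OF uU] and uH = universal_groupD(2)[OF uU]
    show "u \<in> carrier Aut" by (rule uc)
    have "?a \<in> ball b k" using mem_ball_iff[OF b a] by (simp add: k_def)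
    then show "fst u ?a = ?a" using u unfolding ball_fixator_def by blast
    fix x assume x: "x \<in> verts T"
    have un: "u \<in> ball_fixator H b n"
      using u ball_fixator_antimono[of n k H b] by (auto simp: k_def)
    have gx: "\<sigma> g x \<in> carrier Sym" "\<sigma> g (fst u x) \<in> carrier Sym"
      using local_action_Bij g x uc by (simp_all add: carrier_BijGroup)
    have ux: "\<sigma> u x \<in> carrier Sym" by (rule H.mem_carrier[OF uH[OF x]])
    have "inv\<^bsub>Sym\<^esub> (\<sigma> g x) \<otimes>\<^bsub>Sym\<^esub> (\<sigma> g x \<otimes>\<^bsub>Sym\<^esub> (\<sigma> u x \<otimes>\<^bsub>Sym\<^esub> inv\<^bsub>Sym\<^esub> (\<sigma> g x))) =
        \<sigma> u x \<otimes>\<^bsub>Sym\<^esub> inv\<^bsub>Sym\<^esub> (\<sigma> g x)"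
      using gx ux by (simp add: Sym.m_assoc[symmetric])
    \<comment> \<open>Inserting inv \<sigma>(g, x) \<sigma>(g, x) splits the local action into a
      quotient controlled by \<open>orb\<close> and a conjugate controlled by
      \<open>norm\<close>.\<close>
    then have "\<sigma> g (fst u x) \<otimes>\<^bsub>Sym\<^esub> \<sigma> u x \<otimes>\<^bsub>Sym\<^esub> inv\<^bsub>Sym\<^esub> (\<sigma> g x) =
        (\<sigma> g (fst u x) \<otimes>\<^bsub>Sym\<^esub> inv\<^bsub>Sym\<^esub> (\<sigma> g x)) \<otimes>\<^bsub>Sym\<^esub>
        (\<sigma> g x \<otimes>\<^bsub>Sym\<^esub> \<sigma> u x \<otimes>\<^bsub>Sym\<^esub> inv\<^bsub>Sym\<^esub> (\<sigma> g x))"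
      using gx ux by (simp add: Sym.m_assoc)
    then show "\<sigma> g (fst u x) \<otimes>\<^bsub>Sym\<^esub> \<sigma> u x \<otimes>\<^bsub>Sym\<^esub> inv\<^bsub>Sym\<^esub> (\<sigma> g x) \<in> H"
      using H.m_closed[OF orb[OF un x] norm[OF x uH[OF x]]] by (simp only:)
  qed
  then show ?thesis by (rule commensurator_ballI[OF H b M _ bspec[OF m]])
qed

section \<open>The permutation topology and the sets \<Gamma>\<close>

lemma open_nbhd_one:
  assumes "generate_topology_on {{g \<in> carrier Aut. fst g x = y} |x y. x \<in> verts T \<and> y \<in> verts T} W"
    and "\<one>\<^bsub>Aut\<^esub> \<in> W"
  shows "\<exists>X. finite X \<and> X \<subseteq> verts T \<and> {g \<in> carrier Aut. \<forall>x\<in>X. fst g x = x} \<subseteq> W"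
  using assms
proof (induction rule: generate_topology_on.induct)
  case Empty
  then show ?case by simp
next
  case (Int V W)
  then obtain X Y where "finite X" "X \<subseteq> verts T" "{g \<in> carrier Aut. \<forall>x\<in>X. fst g x = x} \<subseteq> V"
    "finite Y" "Y \<subseteq> verts T" "{g \<in> carrier Aut. \<forall>x\<in>Y. fst g x = x} \<subseteq> W"
    by auto
  then show ?case by (intro exI[of _ "X \<union> Y"]) blast
next
  case (UN K)
  then obtain W where W: "W \<in> K" "\<one>\<^bsub>Aut\<^esub> \<in> W" by blast
  from UN.IH[OF W]
  obtain X where X: "finite X" "X \<subseteq> verts T" "{g \<in> carrier Aut. \<forall>x\<in>X. fst g x = x} \<subseteq> W"
    by (elim exE conjE)
  have "W \<subseteq> \<Union>K" using W(1) by (rule Union_upper)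
  then show ?case using X by (intro exI[of _ X] conjI order_trans[OF X(3)])
next
  case (Basis s)
  then obtain x y where s: "s = {g \<in> carrier Aut. fst g x = y}" "x \<in> verts T" by blast
  \<comment> \<open>A subbasic set containing the identity is a point stabilizer.\<close>
  then have "y = x" using Basis.prems Aut_one(1)[of x] by simp
  then show ?case using s by (intro exI[of _ "{x}"]) simp
qed

lemma open_contains_ball_fixator:
  assumes b: "b \<in> verts T"
    and "openin (subtopology (permutation_topology Aut (verts T) fst) (vertex_stabilizer H b)) L"
    and "\<one>\<^bsub>Aut\<^esub> \<in> L"
  shows "\<exists>n. ball_fixator H b n \<subseteq> L"
proof -
  obtain W where W: "openin (permutation_topology Aut (verts T) fst) W" "L = W \<inter> vertex_stabilizer H b"
    using assms(2) by (auto simp: openin_subtopology)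
  have "\<one>\<^bsub>Aut\<^esub> \<in> W" using W(2) assms(3) by blast
  from open_nbhd_one[OF W(1)[unfolded permutation_topology_def openin_topology_generated_by_iff] this]
  obtain X where X: "finite X" "X \<subseteq> verts T" "{g \<in> carrier Aut. \<forall>x\<in>X. fst g x = x} \<subseteq> W"
    by (elim exE conjE)
  have "\<exists>n. X \<subseteq> ball b n" by (rule finite_subset_ball[OF b X(1,2)])
  then obtain n where n: "X \<subseteq> ball b n" by (rule exE)
  have "ball_fixator H b n \<subseteq> W"
    using X(3) n ball_fixator_carrier[of H b n] unfolding ball_fixator_def by blast
  moreover have "ball_fixator H b n \<subseteq> vertex_stabilizer H b" unfolding ball_fixator_def by blast
  ultimately show ?thesis using W(2) by blast
qed

lemma normalizerD:
  assumes "subgroup F Sym" "H \<subseteq> F" "a \<in> normalizer (Sym\<lparr>carrier := F\<rparr>) H"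
  shows "a \<in> F" "Sym.conj_set a H = H"
proof -
  show a: "a \<in> F" using assms(3) by (simp add: normalizer_def stabilizer_def)
  have "a <#\<^bsub>Sym\<lparr>carrier := F\<rparr>\<^esub> H #>\<^bsub>Sym\<lparr>carrier := F\<rparr>\<^esub> inv\<^bsub>Sym\<lparr>carrier := F\<rparr>\<^esub> a = H"
    using assms(2,3) by (simp add: normalizer_def stabilizer_def)
  then show "Sym.conj_set a H = H"
    unfolding Sym.m_inv_consistent[OF assms(1) a] Sym.conj_set_def l_coset_def r_coset_def by simp
qed

text \<open>The identity of \<open>L\<close> puts \<open>x\<close> into its own orbit, so a single
  coset contains \<sigma>(g, x) and all \<sigma>(g, u x); their quotients then lie in
  \<open>H\<close> by \<open>coset_div_in\<close>.\<close>

lemma partition_group_local_action: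
  assumes g: "g \<in> partition_group T arev \<Omega> l (orbits (Aut\<lparr>carrier := L\<rparr>) (verts T) fst)
      (rcosets\<^bsub>Sym\<lparr>carrier := N\<rparr>\<^esub> H)"
    and "\<one>\<^bsub>Aut\<^esub> \<in> L" and x: "x \<in> verts T"
  shows "\<exists>a\<in>N. \<sigma> g x \<in> H #>\<^bsub>Sym\<^esub> a \<and> (\<forall>u\<in>L. \<sigma> g (fst u x) \<in> H #>\<^bsub>Sym\<^esub> a)"
proof -
  let ?O = "orbit (Aut\<lparr>carrier := L\<rparr>) fst x"
  have "?O \<in> orbits (Aut\<lparr>carrier := L\<rparr>) (verts T) fst" using x unfolding orbits_def by blast
  then obtain K where K: "K \<in> rcosets\<^bsub>Sym\<lparr>carrier := N\<rparr>\<^esub> H" "\<forall>v\<in>?O. \<sigma> g v \<in> K"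
    using g unfolding partition_group_def by blast
  then obtain a where a: "a \<in> N" "K = H #>\<^bsub>Sym\<^esub> a"
    by (auto simp: RCOSETS_def r_coset_def)
  have O: "fst u x \<in> ?O" if "u \<in> L" for u 
    unfolding orbit_def using that by (intro CollectI exI[of _ u]) simp
  have "x \<in> ?O" using O[OF assms(2)] x by (simp add: Aut_one)
  then show ?thesis using a K(2) O by blast
qed

lemma partition_group_commensurates:
  assumes H: "subgroup H Sym" and F: "subgroup F Sym" "H \<subseteq> F" and b: "b \<in> verts T"
    and M: "subgroup M Aut" "universal_group T arev \<Omega> l F \<subseteq> M"
    and L: "openin (subtopology (permutation_topology Aut (verts T) fst) (vertex_stabilizer H b)) L"
      "\<one>\<^bsub>Aut\<^esub> \<in> L"
    and g: "g \<in> partition_group T arev \<Omega> l (orbits (Aut\<lparr>carrier := L\<rparr>) (verts T) fst)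
      (rcosets\<^bsub>Sym\<lparr>carrier := normalizer (Sym\<lparr>carrier := F\<rparr>) H\<rparr>\<^esub> H)"
  shows "g \<in> commensurator (Aut\<lparr>carrier := M\<rparr>) (vertex_stabilizer H b)"
proof -
  interpret F: subgroup F Sym by fact
  let ?N = "normalizer (Sym\<lparr>carrier := F\<rparr>) H"
  note N = normalizerD[OF F]
  have gc: "g \<in> carrier Aut" using g by (simp add: partition_group_def)
  obtain n where n: "ball_fixator H b n \<subseteq> L" using open_contains_ball_fixator[OF b L] by (rule exE)
  have coset: "\<exists>a\<in>?N. \<sigma> g x \<in> H #>\<^bsub>Sym\<^esub> a \<and> (\<forall>u\<in>L. \<sigma> g (fst u x) \<in> H #>\<^bsub>Sym\<^esub> a)"
    if "x \<in> verts T" for x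
    by (rule partition_group_local_action[OF g L(2) that])
  have "\<sigma> g x \<in> F" if x: "x \<in> verts T" for x
  proof -
    obtain a where a: "a \<in> ?N" "\<sigma> g x \<in> H #>\<^bsub>Sym\<^esub> a" using coset[OF x] by blast
    then obtain h where "h \<in> H" "\<sigma> g x = h \<otimes>\<^bsub>Sym\<^esub> a" by (auto simp: r_coset_def)
    then show ?thesis using N(1)[OF a(1)] F(2) by auto
  qed
  then have "g \<in> M" using M(2) gc by (auto simp: universal_group_def)
  moreover have "vertex_stabilizer H b \<subseteq> M"
    using M(2) F(2) unfolding vertex_stabilizer_def universal_group_def by blast
  ultimately show ?thesis
  proof (intro normalizing_commensurates[OF H b M(1), of _ n])
    fix x h assume x: "x \<in> verts T" and h: "h \<in> H"
    obtain a where a: "a \<in> ?N" "\<sigma> g x \<in> H #>\<^bsub>Sym\<^esub> a" using coset[OF x] by blast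
    have ac: "a \<in> carrier Sym" by (rule F.mem_carrier[OF N(1)[OF a(1)]])
    show "\<sigma> g x \<otimes>\<^bsub>Sym\<^esub> h \<otimes>\<^bsub>Sym\<^esub> inv\<^bsub>Sym\<^esub> (\<sigma> g x) \<in> H"
      "inv\<^bsub>Sym\<^esub> (\<sigma> g x) \<otimes>\<^bsub>Sym\<^esub> h \<otimes>\<^bsub>Sym\<^esub> \<sigma> g x \<in> H"
      by (rule Sym.coset_normalizes[OF H ac N(2)[OF a(1)] a(2) h])+
  next
    fix u x assume u: "u \<in> ball_fixator H b n" and x: "x \<in> verts T"
    obtain a where a: "a \<in> ?N" "\<sigma> g x \<in> H #>\<^bsub>Sym\<^esub> a" "\<sigma> g (fst u x) \<in> H #>\<^bsub>Sym\<^esub> a"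
      using coset[OF x] u n by blast
    have ac: "a \<in> carrier Sym" by (rule F.mem_carrier[OF N(1)[OF a(1)]])
    show "\<sigma> g (fst u x) \<otimes>\<^bsub>Sym\<^esub> inv\<^bsub>Sym\<^esub> (\<sigma> g x) \<in> H"
      by (rule Sym.coset_div_in[OF H ac a(2,3)])
  qed
qed

section \<open>Transitivity of U({id}) and generation of the commensurator\<close>

lemma ex_universal_one_map:
  assumes "x \<in> verts T" "y \<in> verts T"
  shows "\<exists>u\<in>universal_group T arev \<Omega> l {\<one>\<^bsub>Sym\<^esub>}. fst u x = y"
proof -
  obtain u where "u \<in> carrier Aut" "fst u x = y" "\<And>z. z \<in> verts T \<Longrightarrow> \<sigma> u z = \<one>\<^bsub>Sym\<^esub>"
  proof (rule ex_automorphism[OF assms, of "\<lambda>_. \<one>\<^bsub>Sym\<^esub>"])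
    show "\<one>\<^bsub>Sym\<^esub> \<in> Bij \<Omega>" using Sym.one_closed by (simp only: carrier_BijGroup)
  qed auto
  then show ?thesis unfolding universal_group_def by blast
qed

lemma commensurator_eq_generate:
  assumes H: "subgroup H Sym" and b: "b \<in> verts T"
    and M: "subgroup M Aut" "universal_group T arev \<Omega> l H \<subseteq> M"
  shows "commensurator (Aut\<lparr>carrier := M\<rparr>) (vertex_stabilizer H b) =
    generate Aut (universal_group T arev \<Omega> l {\<one>\<^bsub>Sym\<^esub>} \<union>
      commensurator (Aut\<lparr>carrier := {g \<in> M. fst g b = b}\<rparr>) (vertex_stabilizer H b))"
    (is "?C = generate Aut (?U \<union> ?Cb)")
proof
  interpret M: subgroup M Aut by fact
  let ?Mb = "{g \<in> M. fst g b = b}"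
  have S: "subgroup (vertex_stabilizer H b) Aut" by (rule subgroup_vertex_stabilizer[OF H b])
  have Mb: "subgroup ?Mb Aut" by (rule subgroup_stabilizer[OF M(1) b])
  have SM: "vertex_stabilizer H b \<subseteq> M" using M(2) unfolding vertex_stabilizer_def by blast
  have SMb: "vertex_stabilizer H b \<subseteq> ?Mb" using M(2) unfolding vertex_stabilizer_def by blast
  note C = Aut.commensurator_iff[OF M(1) S SM] and Cb = Aut.commensurator_iff[OF Mb S SMb]
  have subC: "subgroup ?C Aut" by (rule Aut.subgroup_commensurator[OF M(1) S SM])
  have UH: "?U \<subseteq> universal_group T arev \<Omega> l H"
    using subgroup.one_closed[OF H] unfolding universal_group_def by auto
  have UC: "?U \<subseteq> ?C"
  proof
    fix u assume u: "u \<in> ?U"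
    then have uH: "u \<in> universal_group T arev \<Omega> l H" using UH by blast
    \<comment> \<open>An element of U(H) has no exceptional vertices, so the almost universal case
      covers it.\<close>
    then have "u \<in> almost_universal_group T arev \<Omega> l H"
      using universal_subset_restricted[OF subset_refl subset_refl, of H]
      unfolding restricted_universal_group_def by blast
    then show "u \<in> ?C"
      using almost_universal_commensurates[OF H b M(1) SM] uH M(2) by blast
  qed
  moreover have "?Cb \<subseteq> ?C" using C Cb by blast
  ultimately show "generate Aut (?U \<union> ?Cb) \<subseteq> ?C"
    by (intro Aut.generate_subgroup_incl[OF _ subC]) blast
  show "?C \<subseteq> generate Aut (?U \<union> ?Cb)"
  proof
    fix g assume g: "g \<in> ?C"
    then have gM: "g \<in> M" using C by blast
    then have gc: "g \<in> carrier Aut" by (rule M.mem_carrier)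
    obtain u where u: "u \<in> ?U" "fst u (fst g b) = b"
      using ex_universal_one_map[OF fst_in_verts[OF gc b] b] by blast
    have uC: "u \<in> ?C" using u(1) UC by blast
    have uc: "u \<in> carrier Aut" by (rule universal_groupD(1)[OF u(1)])
    have "u \<otimes>\<^bsub>Aut\<^esub> g \<in> ?C" by (rule subgroup.m_closed[OF subC uC g])
    moreover from this have "u \<otimes>\<^bsub>Aut\<^esub> g \<in> ?Mb"
      using C u(2) Aut_mult(1)[OF uc gc b] by simp
    \<comment> \<open>Both commensurators ask for the same coverings in \<open>Aut\<close>, so an
      element of \<open>?C\<close> that fixes \<open>b\<close> belongs to
      \<open>?Cb\<close>.\<close>
    ultimately have ug: "u \<otimes>\<^bsub>Aut\<^esub> g \<in> ?Cb" using C Cb by blast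
    have "inv\<^bsub>Aut\<^esub> u \<otimes>\<^bsub>Aut\<^esub> (u \<otimes>\<^bsub>Aut\<^esub> g) \<in> generate Aut (?U \<union> ?Cb)"
      by (intro generate.eng generate.inv generate.incl UnI1[OF u(1)] UnI2[OF ug])
    then show "g \<in> generate Aut (?U \<union> ?Cb)"
      using uc gc by (simp add: Aut.m_assoc[symmetric])
  qed
qed

end

theorem proposition15:
  fixes \<Omega> :: "'c set"
    and d p :: nat
    and T :: "('v, 'e) pre_digraph"
    and arev :: "'e \<Rightarrow> 'e"
    and l :: "'e \<Rightarrow> 'c"
    and b :: 'v
    and F F' Fp :: "('c \<Rightarrow> 'c) set"
  defines "A \<equiv> aut_group T arev"
    and "Sym \<equiv> BijGroup \<Omega>"
  defines "G \<equiv> restricted_universal_group T arev \<Omega> l"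
  defines "S \<equiv> stabilizer (A\<lparr>carrier := universal_group T arev \<Omega> l Fp\<rparr>) fst b"
    and "Gb \<equiv> stabilizer (A\<lparr>carrier := G F F'\<rparr>) fst b"
    and "N \<equiv> normalizer (Sym\<lparr>carrier := F\<rparr>) Fp"
  assumes "finite \<Omega>" and "card \<Omega> = d" and "d \<ge> 3"
    and "regular_tree d T arev" and "legal_coloring T arev \<Omega> l" and "b \<in> verts T"
    and "prime p"
    and "subgroup F Sym" and "subgroup F' Sym"
    and "F \<subseteq> F'" and "F' \<subseteq> orbit_product \<Omega> F"
    and "sylow_subgroup p (Sym\<lparr>carrier := F\<rparr>) Fp"
    and "\<And>\<omega>. \<omega> \<in> \<Omega> \<Longrightarrow>
           sylow_subgroup p
             (Sym\<lparr>carrier := stabilizer (Sym\<lparr>carrier := F\<rparr>) (\<lambda>a. a) \<omega>\<rparr>)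
             (stabilizer (Sym\<lparr>carrier := Fp\<rparr>) (\<lambda>a. a) \<omega>)"
  shows "commensurator (A\<lparr>carrier := G F F'\<rparr>) S =
           generate A (universal_group T arev \<Omega> l {\<one>\<^bsub>Sym\<^esub>} \<union> commensurator (A\<lparr>carrier := Gb\<rparr>) S) \<and>
         generate A
           (G Fp F' \<union>
            \<Union> {partition_group T arev \<Omega> l
                  (orbits (A\<lparr>carrier := L\<rparr>) (verts T) fst)
                  (rcosets\<^bsub>Sym\<lparr>carrier := N\<rparr>\<^esub> Fp)
               |L. subgroup L (A\<lparr>carrier := S\<rparr>) \<and>
                   openin (subtopology (permutation_topology A (verts T) fst) S) L})
           \<subseteq> commensurator (A\<lparr>carrier := G F F'\<rparr>) S"
proof -
  interpret colored_tree T arev l \<Omega>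
    using assms(7,10,11) by unfold_locales (simp_all add: regular_tree_def)
  note b = \<open>b \<in> verts T\<close> and F = \<open>subgroup F Sym\<close>[unfolded Sym_def] and F' = \<open>subgroup F' Sym\<close>[unfolded Sym_def]
  have Fp': "subgroup Fp (BijGroup \<Omega>\<lparr>carrier := F\<rparr>)"
    using \<open>sylow_subgroup p (Sym\<lparr>carrier := F\<rparr>) Fp\<close> unfolding sylow_subgroup_def Sym_def by blast
  have FpF: "Fp \<subseteq> F" using subgroup.subset[OF Fp'] by simp
  have Fp: "subgroup Fp (BijGroup \<Omega>)" by (rule group.incl_subgroup[OF group_BijGroup F Fp'])
  let ?M = "restricted_universal_group T arev \<Omega> l F F'"
  have M: "subgroup ?M Aut" by (rule subgroup_restricted_universal_group[OF F F'])
  have UM: "universal_group T arev \<Omega> l F \<subseteq> ?M"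
    by (rule universal_subset_restricted[OF subset_refl \<open>F \<subseteq> F'\<close>])
  have UpM: "universal_group T arev \<Omega> l Fp \<subseteq> ?M"
    by (rule universal_subset_restricted[OF FpF \<open>F \<subseteq> F'\<close>])
  have S: "S = vertex_stabilizer Fp b"
    by (simp add: S_def A_def stabilizer_def vertex_stabilizer_def)
  have Gb: "Gb = {g \<in> ?M. fst g b = b}"
    by (simp add: Gb_def A_def G_def stabilizer_def)
  let ?C = "commensurator (Aut\<lparr>carrier := ?M\<rparr>) S"
  have SM: "vertex_stabilizer Fp b \<subseteq> ?M" using UpM unfolding vertex_stabilizer_def by blast
  have subC: "subgroup ?C Aut"
    unfolding S by (rule Aut.subgroup_commensurator[OF M subgroup_vertex_stabilizer[OF Fp b] SM])
  have "g \<in> ?C" if g: "g \<in> G Fp F'" for g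
  proof -
    have g': "g \<in> almost_universal_group T arev \<Omega> l Fp" "g \<in> universal_group T arev \<Omega> l F'"
      using g unfolding G_def restricted_universal_group_def by blast+
    \<comment> \<open>Enlarging the local group leaves fewer exceptional vertices, so G(F(p),F')
      lies in G(F,F'), where the commensurator is formed.\<close>
    have "{x \<in> verts T. local_action T \<Omega> l g x \<notin> F} \<subseteq> {x \<in> verts T. local_action T \<Omega> l g x \<notin> Fp}"
      using FpF by blast
    then have "g \<in> almost_universal_group T arev \<Omega> l F"
      using g'(1) unfolding almost_universal_group_def mem_Collect_eq by (meson finite_subset)
    then have "g \<in> ?M" using g'(2) unfolding restricted_universal_group_def by blast
    then show ?thesis
      unfolding S by (rule almost_universal_commensurates[OF Fp b M SM _ g'(1)])
  qed
  moreover have "g \<in> ?C"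
    if L: "subgroup L (A\<lparr>carrier := S\<rparr>)" "openin (subtopology (permutation_topology A (verts T) fst) S) L"
      and g: "g \<in> partition_group T arev \<Omega> l (orbits (A\<lparr>carrier := L\<rparr>) (verts T) fst)
        (rcosets\<^bsub>Sym\<lparr>carrier := N\<rparr>\<^esub> Fp)" for g L
  proof -
    have "\<one>\<^bsub>Aut\<^esub> \<in> L" using subgroup.one_closed[OF L(1)] by (simp add: A_def)
    then show ?thesis
      unfolding S
      by (rule partition_group_commensurates[OF Fp F FpF b M UM L(2)[unfolded A_def S] _
            g[unfolded A_def Sym_def N_def]])
  qed
  \<comment> \<open>Each set \<Gamma> is contained separately; as \<open>?C\<close> is a subgroup,
    containing the generators is enough.\<close>
  ultimately have "G Fp F' \<union>
      \<Union> {partition_group T arev \<Omega> l (orbits (A\<lparr>carrier := L\<rparr>) (verts T) fst)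
            (rcosets\<^bsub>Sym\<lparr>carrier := N\<rparr>\<^esub> Fp)
         |L. subgroup L (A\<lparr>carrier := S\<rparr>) \<and>
             openin (subtopology (permutation_topology A (verts T) fst) S) L} \<subseteq> ?C"
    by blast
  from Aut.generate_subgroup_incl[OF this subC]
    commensurator_eq_generate[OF Fp b M UpM]
  show ?thesis
    unfolding Gb unfolding S A_def Sym_def G_def by blast
qed

end
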